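(* Let $d \geq 1$, let $\mu$ be a Borel measure on $M_d(\mathbb{R})$ and let $s>0$ be a real number such that $\int \|A\|^s\,d\mu(A)<\infty$. Then \[\int \|A\|^s\, d\mu_d(A) \leq K_{d,s}\, e^{\mathbf{M}(\mu,s)}\left(\int \|A\|^s\,d\mu(A)\right)^{d-1}\] where $K_{d,s}:=d^{2+(d+1)s}\max\{d^{1-s},1\}$.
   Context: $M_d(\mathbb{R})$ is the space of real $d\times d$ matrices and $\|\cdot\|$ denotes the Euclidean norm on $\mathbb{R}^d$ and the operator norm it induces on $M_d(\mathbb{R})$. For a Borel measure $\mu$ on $M_d(\mathbb{R})$ and $n\geq 1$, $\mu_n$ is the Borel measure on $M_d(\mathbb{R})$ given by $\mu_n(X):=(\mu\times\cdots\times\mu)(\{(A_1,\ldots,A_n)\in M_d(\mathbb{R})^n : A_1\cdots A_n\in X\})$ ($n$ copies of $\mu$), so that $\int f\,d\mu_n=\int f(A_1\cdots A_n)\,d\mu(A_1)\cdots d\mu(A_n)$. When $\int\|A\|^s\,d\mu(A)<\infty$, the norm pressure is \[\mathbf{M}(\mu,s):=\lim_{n\to\infty}\frac1n\log\left(\int\|A\|^s\,d\mu_n(A)\right)\in[-\infty,+\infty),\] where the limit exists by subadditivity. Conventions: $\log 0:=-\infty$, $e^{-\infty}:=0$. *)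

theory Defs
  imports "HOL-Analysis.Analysis"
begin

(* The operator norm induced by the Euclidean norm; the norm of the type
   real^'n^'n itself is the Frobenius norm. *)
definition opnorm :: "real^'n^'n \<Rightarrow> real" where
  "opnorm A = onorm (\<lambda>x. A *v x)"

(* The ordered product A 1 ** A 2 ** ... ** A n. *)
primrec mat_prod :: "nat \<Rightarrow> (nat \<Rightarrow> real^'n^'n) \<Rightarrow> real^'n^'n" where
  "mat_prod 0 A = mat 1"
| "mat_prod (Suc n) A = mat_prod n A ** A (Suc n)"

(* The measure \<mu>\<^sub>n. No sigma-finiteness of \<mu> is required: if the integral of
   opnorm A powr s is finite, then \<mu> is sigma-finite away from the zero matrix.
   All tuples with a zero entry have product 0, and the set of these tuples is a
   finite disjoint union of boxes. So the values of the product measure on boxes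
   determine this push-forward even if \<mu> has infinite mass at 0. *)
definition mat_conv :: "(real^'n^'n) measure \<Rightarrow> nat \<Rightarrow> (real^'n^'n) measure" where
  "mat_conv \<mu> n = distr (PiM {1..n} (\<lambda>_. \<mu>)) borel (mat_prod n)"

lemma measurable_mat_prod:
  assumes "sets \<mu> = sets (borel :: (real^'n^'n) measure)"
  shows "mat_prod n \<in> measurable (PiM {1..n} (\<lambda>_. \<mu>)) (borel :: (real^'n^'n) measure)"
proof -
  have cont: "continuous_on UNIV (\<lambda>p :: (real^'n^'n) \<times> (real^'n^'n). fst p ** snd p)"
    unfolding matrix_matrix_mult_def by (intro continuous_intros)
  have "mat_prod k \<in> measurable (PiM {1..n} (\<lambda>_. \<mu>)) borel" if "k \<le> n" for k
    using that
  proof (induction k)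
    case 0
    show ?case by simp
  next
    case (Suc k)
    have "(\<lambda>A. A (Suc k)) \<in> measurable (PiM {1..n} (\<lambda>_. \<mu>)) \<mu>"
      using Suc.prems by (intro measurable_component_singleton) simp
    then have comp: "(\<lambda>A. A (Suc k)) \<in> borel_measurable (PiM {1..n} (\<lambda>_. \<mu>))"
      by (simp add: measurable_cong_sets[OF refl assms])
    from borel_measurable_continuous_Pair[OF _ comp cont] Suc
    show ?case by (simp add: borel_measurable_continuous_Pair[OF _ comp cont])
  qed
  then show ?thesis by blast
qed

(* log 0 = -\<infinity> *)
definition elog :: "ennreal \<Rightarrow> ereal" where
  "elog x = (if x = 0 then -\<infinity> else if x = \<infinity> then \<infinity> else ereal (ln (enn2real x)))"

(* e^(-\<infinity>) = 0 *)
definition eexp :: "ereal \<Rightarrow> ennreal" where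
  "eexp x = (if x = -\<infinity> then 0 else if x = \<infinity> then \<infinity> else ennreal (exp (real_of_ereal x)))"

definition norm_moment :: "(real^'n^'n) measure \<Rightarrow> real \<Rightarrow> ennreal" where
  "norm_moment \<mu> s = (\<integral>\<^sup>+ A. ennreal (opnorm A powr s) \<partial>\<mu>)"

(* The limit is taken in the extended reals; the value of the sequence at n = 0 is irrelevant. *)
definition norm_pressure :: "(real^'n^'n) measure \<Rightarrow> real \<Rightarrow> ereal" where
  "norm_pressure \<mu> s = lim (\<lambda>n. ereal (1 / real n) * elog (norm_moment (mat_conv \<mu> n) s))"

definition K_const :: "real \<Rightarrow> real \<Rightarrow> real" where
  "K_const d s = d powr (2 + (d + 1) * s) * max (d powr (1 - s)) 1"

end

theory Submission
  imports Defs
begin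

text \<open>
  The proof integrates Bochi's inequality, which bounds products of d matrices by the joint
  spectral radius. Write d for the dimension, M for the moment of \<mu>, and fix a real number a
  above the exponential of the pressure.

  Fekete's lemma gives an m such that the m-th moment is at most a^m. Let F(v) be the sum of
  a^(-n) times the integral of |B v|^s with respect to \<mu>_n over n < m. Replacing v by A v and
  integrating over A shifts the sum by one term; the term n = m that enters is dominated by the
  term n = 0 that leaves, so the integral of F(A v) is at most a F(v)
  (\<open>contracted_function_exists\<close>). Thus F behaves like the s-th power of a norm which a random
  factor expands in the mean by at most a.

  Choosing the columns of a matrix T in the unit ball of F so that the determinant is maximal
  makes F(T x) comparable to |x|^s with distortion d^(max s 1) (\<open>auerbach_basis\<close>). With S the
  inverse of T, take singular vectors of S: an orthonormal basis u_i whose images S u_i are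
  orthogonal, with lengths \<delta>_i (\<open>adapted_orthonormal_basis\<close>). In this basis every entry a_ij of a
  matrix A is bounded by the operator norm of A. If moreover \<delta>_j \<le> \<delta>_i, then |a_ij|^s is bounded
  by a constant times F(A u_j) / \<delta>_j^s, whose integral is at most a constant times a.

  An entry of a product of d matrices is a sum over paths of d steps through the d indices. The
  scale \<delta> cannot drop strictly at each of d steps, so on every path one factor obeys the second
  bound, while the other d - 1 factors are bounded by their norms (\<open>mat_prod_entry_bound\<close>).
  Integrating the product of independent factors gives a multiple of a M^(d-1), and a tends to the
  exponential of the pressure.

  The measure \<mu> may have infinite mass at the zero matrix and then is not \<sigma>-finite. A tuple with a
  zero entry contributes nothing to any moment, and away from zero a finite moment forces
  \<sigma>-finiteness, so that \<mu> can be replaced by its restriction to the nonzero matrices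
  (\<open>norm_moment_mat_conv_nonzero_part\<close>).
\<close>

section \<open>The operator norm\<close>

lemma norm_mult_le_opnorm: "norm (A *v x) \<le> opnorm A * norm x"
  unfolding opnorm_def by (rule onorm) simp

lemma opnorm_nonneg: "opnorm A \<ge> 0"
  unfolding opnorm_def by (rule onorm_pos_le) simp

lemma opnorm_le: "(\<And>x. norm (A *v x) \<le> b * norm x) \<Longrightarrow> opnorm A \<le> b"
  unfolding opnorm_def by (rule onorm_le) auto

lemma opnorm_mult_le: "opnorm (A ** B) \<le> opnorm A * opnorm B"
proof (rule opnorm_le)
  fix x
  have "norm ((A ** B) *v x) \<le> opnorm A * norm (B *v x)"
    by (simp add: matrix_vector_mul_assoc [symmetric] norm_mult_le_opnorm)
  also have "\<dots> \<le> opnorm A * (opnorm B * norm x)"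
    by (intro mult_left_mono norm_mult_le_opnorm opnorm_nonneg)
  finally show "norm ((A ** B) *v x) \<le> opnorm A * opnorm B * norm x"
    by (simp add: mult.assoc)
qed

lemma opnorm_zero: "opnorm (0 :: real^'n^'n) = 0"
  using opnorm_le[of "0 :: real^'n^'n" 0] opnorm_nonneg[of "0 :: real^'n^'n"] by simp

lemma opnorm_eq_0_iff: "opnorm A = 0 \<longleftrightarrow> A = 0"
  unfolding opnorm_def using onorm_eq_0[of "(*v) A"]
  by (auto simp: matrix_eq)

lemma opnorm_mat_1: "opnorm (mat 1 :: real^'n^'n) = 1"
proof (rule antisym)
  show "opnorm (mat 1 :: real^'n^'n) \<le> 1" by (rule opnorm_le) simp
  show "1 \<le> opnorm (mat 1 :: real^'n^'n)"
    using norm_mult_le_opnorm[of "mat 1 :: real^'n^'n" "axis undefined 1"] by simp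
qed

lemma continuous_on_opnorm: "continuous_on UNIV (opnorm :: real^'n^'n \<Rightarrow> real)"
proof -
  have le: "opnorm A \<le> opnorm B + real CARD('n) * real CARD('n) * dist A B" for A B :: "real^'n^'n"
  proof -
    have "opnorm (A - B) \<le> real CARD('n) * real CARD('n) * dist A B"
      unfolding opnorm_def dist_norm
    proof (rule onorm_le_matrix_component)
      fix i j
      have "\<bar>(A - B) $ i $ j\<bar> \<le> norm ((A - B) $ i)" by (rule component_le_norm_cart)
      also have "\<dots> \<le> norm (A - B)" by (rule Finite_Cartesian_Product.norm_nth_le)
      finally show "\<bar>(A - B) $ i $ j\<bar> \<le> norm (A - B)" .
    qed
    moreover have "opnorm A \<le> opnorm B + opnorm (A - B)"
    proof (rule opnorm_le)
      fix x
      have "norm (A *v x) = norm (B *v x + (A - B) *v x)"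
        by (simp add: matrix_vector_mult_diff_rdistrib)
      also have "\<dots> \<le> opnorm B * norm x + opnorm (A - B) * norm x"
        by (intro norm_triangle_le add_mono norm_mult_le_opnorm)
      finally show "norm (A *v x) \<le> (opnorm B + opnorm (A - B)) * norm x"
        by (simp add: algebra_simps)
    qed
    ultimately show ?thesis by linarith
  qed
  have "(real CARD('n) * real CARD('n))-lipschitz_on UNIV (opnorm :: real^'n^'n \<Rightarrow> real)"
  proof (rule lipschitz_onI)
    fix A B :: "real^'n^'n"
    show "dist (opnorm A) (opnorm B) \<le> real CARD('n) * real CARD('n) * dist A B"
      using le[of A B] le[of B A] unfolding dist_real_def abs_le_iff dist_commute[of B A] by linarith
  qed simp
  then show ?thesis by (rule lipschitz_on_continuous_on)
qed

lemma measurable_opnorm [measurable]: "opnorm \<in> borel_measurable borel"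
  by (rule borel_measurable_continuous_onI[OF continuous_on_opnorm])

lemma continuous_on_mult_vec: "continuous_on UNIV (\<lambda>A :: real^'n^'n. A *v x)"
  unfolding matrix_vector_mult_def by (intro continuous_intros)

lemma measurable_mult_vec [measurable]:
  "(\<lambda>A :: real^'n^'n. A *v x) \<in> borel_measurable borel"
  by (rule borel_measurable_continuous_onI[OF continuous_on_mult_vec])

lemma measurable_matrix_mult_right [measurable]:
  "(\<lambda>A :: real^'n^'n. A ** C) \<in> borel_measurable borel"
  unfolding matrix_matrix_mult_def
  by (rule borel_measurable_continuous_onI) (intro continuous_intros)

section \<open>An orthonormal basis with orthogonal images\<close>

text \<open>
  Testing with t = a / (N + 1) makes the linear term beat the quadratic one unless a = 0.
\<close>
lemma linear_term_eq_0:
  fixes a N :: real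
  assumes *: "\<And>t. 2 * t * a \<le> t\<^sup>2 * N" and N: "N \<ge> 0"
  shows "a = 0"
proof -
  define t where "t = a / (N + 1)"
  have N1: "N + 1 \<noteq> 0" using N by linarith
  have a: "a = t * (N + 1)" unfolding t_def using N1 by (metis nonzero_divide_eq_eq)
  have "2 * t * (t * (N + 1)) \<le> t\<^sup>2 * N" using *[of t] by (subst (asm) a)
  then have "t\<^sup>2 * (N + 2) \<le> 0" unfolding power2_eq_square distrib_left by argo
  then have "t\<^sup>2 \<le> 0" using N by (metis add_nonneg_pos linorder_not_less mult_pos_pos zero_less_numeral)
  then have "t = 0" by simp
  then show ?thesis using a by (metis mult_zero_left)
qed

text \<open>
  This is the construction of the right singular vectors of S. A unit vector u of V maximising
  |S u| satisfies a first-order condition: S u is orthogonal to S w for every w in V orthogonal to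
  u. The orthogonal complement of u in V then has dimension one less.
\<close>
lemma orthonormal_set_orthogonal_images:
  fixes S :: "real^'n^'n"
  assumes "subspace V" "dim V = k"
  shows "\<exists>B. finite B \<and> B \<subseteq> V \<and> card B = k \<and> (\<forall>b\<in>B. norm b = 1) \<and>
           (\<forall>b\<in>B. \<forall>c\<in>B. b \<noteq> c \<longrightarrow> b \<bullet> c = 0 \<and> (S *v b) \<bullet> (S *v c) = 0)"
  using assms
proof (induction k arbitrary: V)
  case 0
  show ?case by (intro exI[of _ "{}"]) auto
next
  case (Suc k)
  let ?K = "V \<inter> sphere 0 1"
  have "compact ?K"
    using closed_subspace[OF Suc.prems(1)] by (intro closed_Int_compact) auto
  moreover have "?K \<noteq> {}"
  proof -
    have "\<not> V \<subseteq> {0}"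
      using Suc.prems(2) dim_eq_0[of V] by auto
    then obtain x where "x \<in> V" "x \<noteq> 0" by auto
    then have "x /\<^sub>R norm x \<in> ?K"
      using Suc.prems(1) by (auto simp: subspace_scale)
    then show ?thesis by blast
  qed
  moreover have "continuous_on ?K (\<lambda>x. norm (S *v x))"
    by (intro continuous_intros)
  ultimately obtain u where u: "u \<in> ?K" and max: "\<And>x. x \<in> ?K \<Longrightarrow> norm (S *v x) \<le> norm (S *v u)"
    using continuous_attains_sup[of ?K "\<lambda>x. norm (S *v x)"] by blast
  then have uV: "u \<in> V" and nu: "norm u = 1" by auto
  have max': "norm (S *v x) \<le> norm (S *v u) * norm x" if "x \<in> V" for x
  proof (cases "x = 0")
    case False
    then have "x /\<^sub>R norm x \<in> ?K"
      using that Suc.prems(1) by (auto simp: subspace_scale)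
    from max[OF this] False show ?thesis
      by (simp add: matrix_vector_mult_scaleR field_simps)
  qed simp
  let ?V = "{y \<in> V. \<forall>x \<in> span {u}. orthogonal x y}"
  have mem: "y \<in> ?V \<longleftrightarrow> y \<in> V \<and> u \<bullet> y = 0" for y
    by (auto simp: span_singleton orthogonal_def)
  have "?V = {y \<in> V. u \<bullet> y = 0}" using mem by blast
  then have "subspace ?V"
    using Suc.prems(1) by (auto simp: subspace_def inner_add_right)
  moreover have "dim ?V = k"
  proof -
    have "span {u} \<subseteq> V" using uV Suc.prems(1) by (simp add: span_minimal)
    then have "dim ?V + dim (span {u}) = Suc k"
      using dim_subspace_orthogonal_to_vectors[of "span {u}" V] Suc.prems by simp
    moreover have "dim (span {u}) = 1"
      using nu by (auto simp: dim_singleton)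
    ultimately show ?thesis by simp
  qed
  ultimately have "\<exists>B. finite B \<and> B \<subseteq> ?V \<and> card B = k \<and> (\<forall>b\<in>B. norm b = 1) \<and>
      (\<forall>b\<in>B. \<forall>c\<in>B. b \<noteq> c \<longrightarrow> b \<bullet> c = 0 \<and> (S *v b) \<bullet> (S *v c) = 0)"
    by (rule Suc.IH)
  then obtain B where B0: "finite B \<and> B \<subseteq> ?V \<and> card B = k \<and> (\<forall>b\<in>B. norm b = 1) \<and>
      (\<forall>b\<in>B. \<forall>c\<in>B. b \<noteq> c \<longrightarrow> b \<bullet> c = 0 \<and> (S *v b) \<bullet> (S *v c) = 0)" ..
  note B = B0[THEN conjunct1] B0[THEN conjunct2, THEN conjunct1]
    B0[THEN conjunct2, THEN conjunct2, THEN conjunct1]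
    B0[THEN conjunct2, THEN conjunct2, THEN conjunct2, THEN conjunct1]
    B0[THEN conjunct2, THEN conjunct2, THEN conjunct2, THEN conjunct2]
  \<comment> \<open>First variation of the maximum: the term of first order in t along u + t w must vanish.\<close>
  have orth: "(S *v u) \<bullet> (S *v w) = 0" if "w \<in> ?V" for w
  proof -
    define a where "a = (S *v u) \<bullet> (S *v w)"
    define N where "N = (norm (S *v u))\<^sup>2 * (norm w)\<^sup>2"
    have *: "2 * t * a \<le> t\<^sup>2 * N" for t
    proof -
      have V: "u + t *\<^sub>R w \<in> V"
        using uV that Suc.prems(1) by (simp add: mem subspace_add subspace_scale)
      have nw: "(norm (u + t *\<^sub>R w))\<^sup>2 = 1 + t\<^sup>2 * (norm w)\<^sup>2"
        using that nu unfolding mem power2_norm_eq_inner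
        by (simp add: inner_add_left inner_add_right inner_commute[of w u] norm_eq_1
            power2_eq_square)
      have "(norm (S *v u))\<^sup>2 + 2 * t * a \<le> (norm (S *v u))\<^sup>2 + 2 * t * a + t\<^sup>2 * (norm (S *v w))\<^sup>2"
        by simp
      also have "\<dots> = (norm (S *v (u + t *\<^sub>R w)))\<^sup>2"
        unfolding a_def power2_norm_eq_inner matrix_vector_right_distrib matrix_vector_mult_scaleR
        by (simp add: inner_add_left inner_add_right inner_commute[of "S *v w" "S *v u"]
            power2_eq_square distrib_left)
      also have "\<dots> \<le> (norm (S *v u))\<^sup>2 * (norm (u + t *\<^sub>R w))\<^sup>2"
        unfolding power_mult_distrib[symmetric] by (intro power_mono max'[OF V]) simp
      also have "\<dots> = (norm (S *v u))\<^sup>2 + t\<^sup>2 * N"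
        unfolding N_def nw by (simp add: distrib_left)
      finally show ?thesis by linarith
    qed
    have "a = 0" by (rule linear_term_eq_0[OF *]) (simp add: N_def)
    then show ?thesis unfolding a_def .
  qed
  have uB: "b \<in> V \<and> u \<bullet> b = 0 \<and> b \<bullet> u = 0 \<and>
      (S *v u) \<bullet> (S *v b) = 0 \<and> (S *v b) \<bullet> (S *v u) = 0" if "b \<in> B" for b
  proof -
    have V: "b \<in> ?V" using B(2) that by (rule subsetD)
    have "b \<in> V \<and> u \<bullet> b = 0" using V by (simp only: mem)
    moreover have "(S *v u) \<bullet> (S *v b) = 0" by (rule orth[OF V])
    ultimately show ?thesis by (simp add: inner_commute[of b u] inner_commute[of "S *v b" "S *v u"])
  qed
  have "u \<notin> B" using uB[of u] nu by (auto simp: norm_eq_1)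
  show ?case
  proof (intro exI[of _ "insert u B"] conjI)
    show "card (insert u B) = Suc k" using \<open>u \<notin> B\<close> B(1,3) by simp
    show "insert u B \<subseteq> V" using uV B(2) by auto
    show "\<forall>b\<in>insert u B. \<forall>c\<in>insert u B. b \<noteq> c \<longrightarrow> b \<bullet> c = 0 \<and> (S *v b) \<bullet> (S *v c) = 0"
    proof (intro ballI impI)
      fix b c assume "b \<in> insert u B" "c \<in> insert u B" "b \<noteq> c"
      then consider "b = u" "c \<in> B" | "c = u" "b \<in> B" | "b \<in> B" "c \<in> B" "b \<noteq> c" by auto
      then show "b \<bullet> c = 0 \<and> (S *v b) \<bullet> (S *v c) = 0"
      proof cases
        case 1 with uB[of c] show ?thesis by simp
      next
        case 2 with uB[of b] show ?thesis by simp
      next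
        case 3 with B(5) show ?thesis by simp
      qed
    qed
    show "\<forall>b\<in>insert u B. norm b = 1" using B(4) nu by simp
  qed (simp add: B(1))
qed

lemma orthonormal_basis_orthogonal_images:
  fixes S :: "real^'n^'n"
  obtains u :: "'n \<Rightarrow> real^'n" where "\<And>i. norm (u i) = 1" "\<And>i j. i \<noteq> j \<Longrightarrow> u i \<bullet> u j = 0"
    "\<And>i j. i \<noteq> j \<Longrightarrow> (S *v u i) \<bullet> (S *v u j) = 0"
    "\<And>y. (\<Sum>i\<in>UNIV. (u i \<bullet> y) *\<^sub>R u i) = y"
proof -
  obtain B where B: "finite B" "card B = CARD('n)" "\<forall>b\<in>B. norm b = 1"
    "\<forall>b\<in>B. \<forall>c\<in>B. b \<noteq> c \<longrightarrow> b \<bullet> c = 0 \<and> (S *v b) \<bullet> (S *v c) = 0"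
    using orthonormal_set_orthogonal_images[of "UNIV :: (real^'n) set" "CARD('n)" S]
    by auto
  obtain u :: "'n \<Rightarrow> real^'n" where u: "bij_betw u UNIV B"
    using finite_same_card_bij[of "UNIV :: 'n set" B] B by auto
  have uB: "u i \<in> B" for i using u by (auto simp: bij_betw_def)
  have inj: "u i \<noteq> u j" if "i \<noteq> j" for i j
    using u that by (auto simp: bij_betw_def inj_on_def)
  have "independent B"
    using B by (intro pairwise_orthogonal_independent)
      (auto simp: pairwise_def orthogonal_def)
  then have span: "span B = UNIV"
    using B(1,2) card_eq_dim[of B UNIV] by auto
  have "(\<Sum>i\<in>UNIV. (u i \<bullet> y) *\<^sub>R u i) = y" for y
  proof -
    have "(\<Sum>i\<in>UNIV. (u i \<bullet> y) *\<^sub>R u i) = (\<Sum>b\<in>B. (b \<bullet> y) *\<^sub>R b)"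
      by (rule sum.reindex_bij_betw[OF u])
    also have "\<dots> = y"
      using orthonormal_basis_expand[of B y] B span
      by (auto simp: pairwise_def orthogonal_def inner_commute)
    finally show ?thesis .
  qed
  then show ?thesis using that[of u] B uB inj by auto
qed

section \<open>Power inequalities\<close>

text \<open>
  The concave power lies below its tangent at 1; here the estimate comes from convexity of the
  exponential between 0 and the logarithm of z.
\<close>
lemma powr_le_affine:
  fixes z t :: real
  assumes "0 < t" "t \<le> 1" "0 \<le> z"
  shows "z powr t \<le> t * z + (1 - t)"
proof (cases "z = 0")
  case False
  then have z: "z > 0" using assms by simp
  have "exp ((1 - (1 - t)) *\<^sub>R ln z + (1 - t) *\<^sub>R 0) \<le> (1 - (1 - t)) * exp (ln z) + (1 - t) * exp 0"
    using assms by (intro convex_onD[OF exp_convex]) auto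
  then show ?thesis using z by (simp add: powr_def)
qed (use assms in simp)

lemma affine_le_powr:
  fixes z s :: real
  assumes "1 \<le> s" "0 \<le> z"
  shows "1 + s * (z - 1) \<le> z powr s"
proof -
  have "(z powr s) powr (1 / s) \<le> 1 / s * z powr s + (1 - 1 / s)"
    using assms by (intro powr_le_affine) auto
  then have "z \<le> 1 / s * z powr s + (1 - 1 / s)"
    using assms by (simp add: powr_powr powr_one)
  then have "s * z \<le> s * (1 / s * z powr s + (1 - 1 / s))"
    using assms by (intro mult_left_mono) auto
  also have "\<dots> = z powr s + (s - 1)"
    using assms by (simp add: distrib_left right_diff_distrib)
  finally show ?thesis by (simp add: algebra_simps)
qed

text \<open>
  The tangent inequality, applied to the values rescaled to have mean 1.
\<close>
lemma sum_powr_le_power_mean: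
  fixes y :: "'a \<Rightarrow> real"
  assumes "finite I" "I \<noteq> {}" "\<And>i. i \<in> I \<Longrightarrow> y i \<ge> 0" and t: "0 < t" "t \<le> 1"
  shows "(\<Sum>i\<in>I. y i powr t) \<le> real (card I) powr (1 - t) * (\<Sum>i\<in>I. y i) powr t"
proof (cases "(\<Sum>i\<in>I. y i) = 0")
  case True
  then have "\<And>i. i \<in> I \<Longrightarrow> y i = 0" using assms by (simp add: sum_nonneg_eq_0_iff)
  then show ?thesis by simp
next
  case False
  define Y where "Y = (\<Sum>i\<in>I. y i)"
  define d where "d = real (card I)"
  have Y: "Y > 0" using False assms unfolding Y_def by (simp add: less_le sum_nonneg)
  have d: "d > 0" using assms unfolding d_def by (simp add: card_gt_0_iff)
  have "(\<Sum>i\<in>I. (d * y i / Y) powr t) \<le> (\<Sum>i\<in>I. t * (d * y i / Y) + (1 - t))"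
    using assms Y d by (intro sum_mono powr_le_affine) auto
  also have "\<dots> = (\<Sum>i\<in>I. t * d / Y * y i) + d * (1 - t)"
    unfolding d_def by (simp add: sum.distrib mult.assoc)
  also have "(\<Sum>i\<in>I. t * d / Y * y i) = t * d / Y * Y"
    unfolding Y_def by (simp only: sum_distrib_left[symmetric])
  also have "t * d / Y * Y + d * (1 - t) = d"
    using Y by (simp add: right_diff_distrib)
  finally have *: "(\<Sum>i\<in>I. (d * y i / Y) powr t) \<le> d" .
  have "y i powr t = (Y / d) powr t * (d * y i / Y) powr t" if "i \<in> I" for i
    using Y d assms(3)[OF that] by (simp add: powr_mult[symmetric])
  then have "(\<Sum>i\<in>I. y i powr t) = (Y / d) powr t * (\<Sum>i\<in>I. (d * y i / Y) powr t)"
    by (simp add: sum_distrib_left)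
  also have "\<dots> \<le> (Y / d) powr t * d"
    using * by (intro mult_left_mono) auto
  also have "\<dots> = d powr (1 - t) * Y powr t"
    using Y d by (simp add: powr_divide powr_diff)
  finally show ?thesis unfolding Y_def d_def .
qed

text \<open>
  After dividing by the sum all terms lie in [0, 1], where raising to the power s does not
  decrease them.
\<close>
lemma powr_sum_le_sum_powr:
  fixes a :: "'a \<Rightarrow> real"
  assumes "finite I" "\<And>i. i \<in> I \<Longrightarrow> a i \<ge> 0" and s: "0 < s" "s \<le> 1"
  shows "(\<Sum>i\<in>I. a i) powr s \<le> (\<Sum>i\<in>I. a i powr s)"
proof (cases "(\<Sum>i\<in>I. a i) = 0")
  case True
  then show ?thesis by (simp add: sum_nonneg)
next
  case False
  define Y where "Y = (\<Sum>i\<in>I. a i)"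
  have Y: "Y > 0" using False assms unfolding Y_def by (simp add: less_le sum_nonneg)
  have le: "a i / Y \<le> (a i / Y) powr s" if "i \<in> I" for i
  proof -
    have "a i \<le> Y" unfolding Y_def using assms that by (intro member_le_sum) auto
    then have "(a i / Y) powr 1 \<le> (a i / Y) powr s"
      using Y s assms(2)[OF that] by (intro powr_mono') (auto simp: divide_le_eq)
    then show ?thesis using Y assms(2)[OF that] by simp
  qed
  have "Y powr s = Y powr s * (\<Sum>i\<in>I. a i / Y)"
    using Y unfolding Y_def by (simp add: sum_divide_distrib[symmetric])
  also have "\<dots> \<le> Y powr s * (\<Sum>i\<in>I. (a i / Y) powr s)"
    using le by (intro mult_left_mono sum_mono) auto
  also have "\<dots> = (\<Sum>i\<in>I. a i powr s)"
    using Y assms by (simp add: sum_distrib_left powr_divide)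
  finally show ?thesis unfolding Y_def .
qed

text \<open>
  Jensen's inequality for the convex power, by the tangent at the weighted mean. The weights are
  not normalised, which accounts for the power of their sum.
\<close>
lemma powr_weighted_sum_le:
  fixes a c :: "'a \<Rightarrow> real"
  assumes "finite I" "\<And>i. i \<in> I \<Longrightarrow> a i \<ge> 0" "\<And>i. i \<in> I \<Longrightarrow> c i \<ge> 0" and s: "1 \<le> s"
  shows "(\<Sum>i\<in>I. c i * a i) powr s \<le> (\<Sum>i\<in>I. c i) powr (s - 1) * (\<Sum>i\<in>I. c i * a i powr s)"
proof (cases "(\<Sum>i\<in>I. c i * a i) = 0")
  case True
  have "0 \<le> (\<Sum>i\<in>I. c i * a i powr s)" using assms by (intro sum_nonneg) auto
  then show ?thesis using True by simp
next
  case False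
  define M where "M = (\<Sum>i\<in>I. c i * a i)"
  define C where "C = (\<Sum>i\<in>I. c i)"
  have M: "M > 0" using False assms unfolding M_def by (simp add: less_le sum_nonneg)
  have "C \<noteq> 0"
  proof
    assume "C = 0"
    then have "\<And>i. i \<in> I \<Longrightarrow> c i = 0" using assms unfolding C_def by (simp add: sum_nonneg_eq_0_iff)
    then show False using M unfolding M_def by simp
  qed
  then have C: "C > 0" using assms unfolding C_def by (simp add: less_le sum_nonneg)
  define m where "m = M / C"
  have m: "m > 0" unfolding m_def using M C by simp
  have "C = C + s * (M / m - C)" unfolding m_def using M C by simp
  also have "\<dots> = (\<Sum>i\<in>I. c i + s * (c i * a i / m - c i))"
    unfolding C_def M_def
    by (simp only: sum.distrib sum_distrib_left[symmetric] sum_subtractf sum_divide_distrib)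
  also have "\<dots> = (\<Sum>i\<in>I. c i * (1 + s * (a i / m - 1)))"
    by (intro sum.cong refl) (simp add: algebra_simps)
  also have "\<dots> \<le> (\<Sum>i\<in>I. c i * (a i / m) powr s)"
    using assms m by (intro sum_mono mult_left_mono affine_le_powr) auto
  also have "\<dots> = (\<Sum>i\<in>I. c i * a i powr s) / m powr s"
    using assms m by (simp add: powr_divide sum_divide_distrib)
  finally have "C * m powr s \<le> (\<Sum>i\<in>I. c i * a i powr s)"
    using m by (simp add: le_divide_eq)
  then have "C powr (s - 1) * (C * m powr s) \<le> C powr (s - 1) * (\<Sum>i\<in>I. c i * a i powr s)"
    by (intro mult_left_mono) auto
  moreover have "C powr (s - 1) * (C * m powr s) = M powr s"
    using C M unfolding m_def by (simp add: powr_divide powr_diff)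
  ultimately show ?thesis unfolding M_def C_def by simp
qed

text \<open>
  For s \<le> 1 the s-th power of the norm is subadditive, for s \<ge> 1 it is convex. The exponents
  min s 1 and max s 1, whose product is s, express both estimates by one formula. It is linear in
  the powers of the norms, and so it passes to integrals.
\<close>
lemma norm_sum_powr_le:
  fixes w :: "'a \<Rightarrow> 'b::real_normed_vector"
  assumes "finite I" "s > 0"
  shows "norm (\<Sum>i\<in>I. c i *\<^sub>R w i) powr s
    \<le> (\<Sum>i\<in>I. \<bar>c i\<bar> powr min s 1) powr (max s 1 - 1) * (\<Sum>i\<in>I. \<bar>c i\<bar> powr min s 1 * norm (w i) powr s)"
proof -
  have "norm (\<Sum>i\<in>I. c i *\<^sub>R w i) \<le> (\<Sum>i\<in>I. \<bar>c i\<bar> * norm (w i))"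
    by (rule order_trans[OF norm_sum]) simp
  then have 1: "norm (\<Sum>i\<in>I. c i *\<^sub>R w i) powr s \<le> (\<Sum>i\<in>I. \<bar>c i\<bar> * norm (w i)) powr s"
    using assms by (intro powr_mono2) auto
  show ?thesis
  proof (cases "s \<le> 1")
    case True
    have "(\<Sum>i\<in>I. \<bar>c i\<bar> * norm (w i)) powr s \<le> (\<Sum>i\<in>I. (\<bar>c i\<bar> * norm (w i)) powr s)"
      using assms True by (intro powr_sum_le_sum_powr) auto
    also have "\<dots> = (\<Sum>i\<in>I. \<bar>c i\<bar> powr s * norm (w i) powr s)"
      by (simp add: powr_mult)
    finally have *: "norm (\<Sum>i\<in>I. c i *\<^sub>R w i) powr s \<le> (\<Sum>i\<in>I. \<bar>c i\<bar> powr s * norm (w i) powr s)"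
      using 1 by simp
    show ?thesis
    proof (cases "(\<Sum>i\<in>I. \<bar>c i\<bar> powr s) = 0")
      case True
      \<comment> \<open>Here the first factor is the degenerate power 0 powr 0 = 0, but all coefficients vanish.\<close>
      then have "\<And>i. i \<in> I \<Longrightarrow> c i = 0" using assms by (simp add: sum_nonneg_eq_0_iff)
      then have "(\<Sum>i\<in>I. c i *\<^sub>R w i) = 0" by simp
      then show ?thesis using assms by (simp add: sum_nonneg)
    next
      case False
      then show ?thesis using True * by (simp add: min_def max_def)
    qed
  next
    case False
    have "(\<Sum>i\<in>I. \<bar>c i\<bar> * norm (w i)) powr s
        \<le> (\<Sum>i\<in>I. \<bar>c i\<bar>) powr (s - 1) * (\<Sum>i\<in>I. \<bar>c i\<bar> * norm (w i) powr s)"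
      using assms False by (intro powr_weighted_sum_le) auto
    with 1 False show ?thesis by (simp add: min_def max_def)
  qed
qed

section \<open>Products of matrices in an adapted basis\<close>

lemma norm_squared_eq_sum_coords:
  fixes u :: "'n::finite \<Rightarrow> 'a::real_inner"
  assumes "(\<Sum>i\<in>UNIV. (u i \<bullet> y) *\<^sub>R u i) = y"
  shows "(norm y)\<^sup>2 = (\<Sum>i\<in>UNIV. (u i \<bullet> y)\<^sup>2)"
proof -
  have "(norm y)\<^sup>2 = (\<Sum>i\<in>UNIV. (u i \<bullet> y) *\<^sub>R u i) \<bullet> y"
    unfolding assms by (rule power2_norm_eq_inner)
  then show ?thesis by (simp add: inner_sum_left power2_eq_square)
qed

text \<open>
  Entries bounded by m give a Frobenius norm of at most d m.
\<close>
lemma opnorm_le_entries: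
  fixes u :: "'n \<Rightarrow> real^'n" and B :: "real^'n^'n"
  assumes u: "\<And>y. (\<Sum>i\<in>UNIV. (u i \<bullet> y) *\<^sub>R u i) = y"
    and m: "\<And>i j. \<bar>u i \<bullet> (B *v u j)\<bar> \<le> m"
  shows "opnorm B \<le> real CARD('n) * m"
proof (rule opnorm_le)
  fix x :: "real^'n"
  let ?d = "real CARD('n)"
  have m0: "m \<ge> 0" using m[of undefined undefined] by linarith
  have "(u i \<bullet> (B *v x))\<^sup>2 \<le> m\<^sup>2 * (?d * (norm x)\<^sup>2)" for i
  proof -
    have "B *v x = (\<Sum>j\<in>UNIV. (u j \<bullet> x) *\<^sub>R (B *v u j))"
      by (subst (1) u[of x, symmetric])
        (simp add: matrix_vector_mult_scaleR linear_sum[OF matrix_vector_mul_linear])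
    then have "\<bar>u i \<bullet> (B *v x)\<bar> = \<bar>\<Sum>j\<in>UNIV. (u j \<bullet> x) * (u i \<bullet> (B *v u j))\<bar>"
      by (simp add: inner_sum_right)
    also have "\<dots> \<le> (\<Sum>j\<in>UNIV. \<bar>u j \<bullet> x\<bar> * m)"
      by (intro order_trans[OF sum_abs] sum_mono) (simp add: abs_mult mult_left_mono m)
    finally have "\<bar>u i \<bullet> (B *v x)\<bar> \<le> m * (\<Sum>j\<in>UNIV. \<bar>u j \<bullet> x\<bar>)"
      by (simp add: sum_distrib_left mult.commute)
    then have "\<bar>u i \<bullet> (B *v x)\<bar>\<^sup>2 \<le> (m * (\<Sum>j\<in>UNIV. \<bar>u j \<bullet> x\<bar>))\<^sup>2"
      by (intro power_mono) auto
    also have "\<dots> \<le> m\<^sup>2 * ((\<Sum>j\<in>UNIV. \<bar>u j \<bullet> x\<bar>\<^sup>2) * ?d)"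
      unfolding power_mult_distrib
      by (intro mult_left_mono sum_squared_le_sum_of_squares) auto
    also have "(\<Sum>j\<in>UNIV. \<bar>u j \<bullet> x\<bar>\<^sup>2) = (norm x)\<^sup>2"
      unfolding norm_squared_eq_sum_coords[OF u] by simp
    finally show ?thesis by (simp add: mult.commute)
  qed
  then have "(\<Sum>i\<in>UNIV. (u i \<bullet> (B *v x))\<^sup>2) \<le> (\<Sum>i\<in>(UNIV::'n set). m\<^sup>2 * (?d * (norm x)\<^sup>2))"
    by (intro sum_mono)
  then have "(norm (B *v x))\<^sup>2 \<le> (?d * m * norm x)\<^sup>2"
    unfolding norm_squared_eq_sum_coords[OF u, of "B *v x"]
    by (simp add: power_mult_distrib power2_eq_square mult_ac)
  then show "norm (B *v x) \<le> ?d * m * norm x"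
    using m0 by (intro power2_le_imp_le[of "norm (B *v x)"]) auto
qed

lemma opnorm_mat_prod_le: "opnorm (mat_prod n A) \<le> (\<Prod>k\<in>{1..n}. opnorm (A k))"
proof (induction n)
  case 0
  show ?case by (simp add: opnorm_mat_1)
next
  case (Suc n)
  have "opnorm (mat_prod (Suc n) A) \<le> opnorm (mat_prod n A) * opnorm (A (Suc n))"
    by (simp add: opnorm_mult_le)
  also have "\<dots> \<le> (\<Prod>k\<in>{1..n}. opnorm (A k)) * opnorm (A (Suc n))"
    by (intro mult_right_mono Suc.IH opnorm_nonneg)
  finally show ?case by (simp add: prod.nat_ivl_Suc' mult.commute)
qed

lemma abs_entry_le_opnorm:
  assumes "\<And>i. norm (u i) = 1"
  shows "\<bar>u i \<bullet> (A *v u j)\<bar> \<le> opnorm A"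
  using Cauchy_Schwarz_ineq2[of "u i" "A *v u j"] norm_mult_le_opnorm[of A "u j"] assms by simp

text \<open>
  The path argument. The rank of j is the number of indices of smaller scale. Expanding the last
  factor in the basis turns an entry of column j into a sum over the next index l. Either the scale
  does not drop, and then the last factor obeys the bound \<beta> and all others their norms; or l has
  smaller rank, and induction applies to one factor less. The factor c carries the norms of the
  factors that have already been split off, so that no division by a vanishing norm occurs.
  The constant is the number of choices for the n - 1 intermediate indices.
\<close>
lemma mat_prod_entry_bound:
  fixes u :: "'n \<Rightarrow> real^'n" and A :: "nat \<Rightarrow> real^'n^'n" and \<delta> :: "'n \<Rightarrow> real"
  assumes unit: "\<And>i. norm (u i) = 1" and u: "\<And>y. (\<Sum>i\<in>UNIV. (u i \<bullet> y) *\<^sub>R u i) = y"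
    and \<beta>: "\<And>k i j. \<delta> j \<le> \<delta> i \<Longrightarrow> \<bar>u i \<bullet> (A k *v u j)\<bar> \<le> \<beta> k"
    and "n \<ge> 1" "c \<ge> 0" "card {l. \<delta> l < \<delta> j} < n"
    and "\<And>k. k \<in> {1..n} \<Longrightarrow> c * (\<beta> k * (\<Prod>l\<in>{1..n} - {k}. opnorm (A l))) \<le> G"
  shows "c * \<bar>u i \<bullet> (mat_prod n A *v u j)\<bar> \<le> real CARD('n) ^ (n - 1) * G"
  using assms(4-)
proof (induction n arbitrary: j c rule: nat_induct_at_least)
  case base
  then have "{l. \<delta> l < \<delta> j} = {}" by (simp add: card_eq_0_iff)
  then have "\<delta> j \<le> \<delta> i" by (auto simp: not_less)
  then have "c * \<bar>u i \<bullet> (A 1 *v u j)\<bar> \<le> c * \<beta> 1"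
    using base by (intro mult_left_mono \<beta>) auto
  also have "\<dots> \<le> G" using base(3)[of 1] by simp
  finally show ?case by simp
next
  case (Suc n)
  let ?d = "real CARD('n)"
  let ?P = "mat_prod n A"
  have \<beta>0: "0 \<le> \<beta> k" for k using \<beta>[of undefined undefined k] by fastforce
  have "0 \<le> c * (\<beta> 1 * (\<Prod>l\<in>{1..Suc n} - {1}. opnorm (A l)))"
    using \<open>c \<ge> 0\<close> \<beta>0 by (intro mult_nonneg_nonneg prod_nonneg) (auto simp: opnorm_nonneg)
  also have "\<dots> \<le> G" by (rule Suc.prems(3)) simp
  finally have G: "0 \<le> G" .
  have term_le: "c * (\<bar>u l \<bullet> (A (Suc n) *v u j)\<bar> * \<bar>u i \<bullet> (?P *v u l)\<bar>) \<le> ?d ^ (n - 1) * G" for l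
  proof (cases "\<delta> l < \<delta> j")
    case True
    \<comment> \<open>The scale has dropped, so the remaining path to row i starts at an index of smaller rank.\<close>
    have "{m. \<delta> m < \<delta> l} \<subset> {m. \<delta> m < \<delta> j}" using True by auto
    then have "card {m. \<delta> m < \<delta> l} < card {m. \<delta> m < \<delta> j}" by (intro psubset_card_mono) auto
    then have rank: "card {m. \<delta> m < \<delta> l} < n" using Suc.prems(2) by simp
    have "c * (\<bar>u l \<bullet> (A (Suc n) *v u j)\<bar> * \<bar>u i \<bullet> (?P *v u l)\<bar>)
        \<le> c * (opnorm (A (Suc n)) * \<bar>u i \<bullet> (?P *v u l)\<bar>)"
      using \<open>c \<ge> 0\<close> by (intro mult_left_mono mult_right_mono abs_entry_le_opnorm unit) auto
    also have "\<dots> = (c * opnorm (A (Suc n))) * \<bar>u i \<bullet> (?P *v u l)\<bar>" by simp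
    also have "\<dots> \<le> ?d ^ (n - 1) * G"
    proof (rule Suc.IH[OF _ rank])
      show "0 \<le> c * opnorm (A (Suc n))" using \<open>c \<ge> 0\<close> by (simp add: opnorm_nonneg)
      fix k assume k: "k \<in> {1..n}"
      then have "{1..Suc n} - {k} = insert (Suc n) ({1..n} - {k})" by auto
      then have "(\<Prod>l\<in>{1..Suc n} - {k}. opnorm (A l))
          = opnorm (A (Suc n)) * (\<Prod>l\<in>{1..n} - {k}. opnorm (A l))"
        by simp
      with Suc.prems(3)[of k] k
      show "c * opnorm (A (Suc n)) * (\<beta> k * (\<Prod>l\<in>{1..n} - {k}. opnorm (A l))) \<le> G"
        by (simp add: mult_ac)
    qed
    finally show ?thesis .
  next
    case False
    have "\<bar>u i \<bullet> (?P *v u l)\<bar> \<le> (\<Prod>l\<in>{1..n}. opnorm (A l))"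
      using abs_entry_le_opnorm[of u i ?P l] unit opnorm_mat_prod_le[of n A] by force
    then have "c * (\<bar>u l \<bullet> (A (Suc n) *v u j)\<bar> * \<bar>u i \<bullet> (?P *v u l)\<bar>)
        \<le> c * (\<beta> (Suc n) * (\<Prod>l\<in>{1..n}. opnorm (A l)))"
      using \<open>c \<ge> 0\<close> False \<beta>0 by (intro mult_left_mono mult_mono \<beta>) auto
    also have "{1..n} = {1..Suc n} - {Suc n}" by auto
    also have "c * (\<beta> (Suc n) * (\<Prod>l\<in>{1..Suc n} - {Suc n}. opnorm (A l))) \<le> G"
      by (rule Suc.prems(3)) simp
    also have "G \<le> ?d ^ (n - 1) * G"
    proof -
      have "1 \<le> ?d ^ (n - 1)" by (rule one_le_power) (simp add: Suc_le_eq)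
      from mult_right_mono[OF this G] show ?thesis by simp
    qed
    finally show ?thesis .
  qed
  have "mat_prod (Suc n) A *v u j = ?P *v (A (Suc n) *v u j)"
    by (simp add: matrix_vector_mul_assoc)
  also have "\<dots> = (\<Sum>l\<in>UNIV. (u l \<bullet> (A (Suc n) *v u j)) *\<^sub>R (?P *v u l))"
    by (subst (1) u[of "A (Suc n) *v u j", symmetric])
      (simp add: matrix_vector_mult_scaleR linear_sum[OF matrix_vector_mul_linear])
  finally have "\<bar>u i \<bullet> (mat_prod (Suc n) A *v u j)\<bar>
      \<le> (\<Sum>l\<in>UNIV. \<bar>u l \<bullet> (A (Suc n) *v u j)\<bar> * \<bar>u i \<bullet> (?P *v u l)\<bar>)"
    by (simp add: inner_sum_right abs_mult[symmetric])
  then have "c * \<bar>u i \<bullet> (mat_prod (Suc n) A *v u j)\<bar>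
      \<le> (\<Sum>l\<in>UNIV. c * (\<bar>u l \<bullet> (A (Suc n) *v u j)\<bar> * \<bar>u i \<bullet> (?P *v u l)\<bar>))"
    unfolding sum_distrib_left[symmetric] using \<open>c \<ge> 0\<close> by (rule mult_left_mono)
  also have "\<dots> \<le> (\<Sum>l\<in>(UNIV::'n set). ?d ^ (n - 1) * G)"
    by (intro sum_mono term_le)
  also have "\<dots> = ?d * ?d ^ (n - 1) * G" by simp
  also have "?d * ?d ^ (n - 1) = ?d ^ (Suc n - 1)"
    using \<open>n \<ge> 1\<close> by (metis Suc_diff_1 diff_Suc_1 less_le_trans power_Suc zero_less_one)
  finally show ?case .
qed

text \<open>
  Every rank is below d, so the path argument applies to all entries of a product of length d.
  The common bound G on the d products is their l^s norm, whose s-th power is the sum over the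
  position of the exceptional factor.
\<close>
lemma opnorm_mat_prod_powr_le:
  fixes u :: "'n \<Rightarrow> real^'n" and A :: "nat \<Rightarrow> real^'n^'n" and \<delta> :: "'n \<Rightarrow> real"
  assumes unit: "\<And>i. norm (u i) = 1" and u: "\<And>y. (\<Sum>i\<in>UNIV. (u i \<bullet> y) *\<^sub>R u i) = y"
    and \<beta>: "\<And>k i j. \<delta> j \<le> \<delta> i \<Longrightarrow> \<bar>u i \<bullet> (A k *v u j)\<bar> \<le> \<beta> k"
    and s: "s > 0"
  shows "opnorm (mat_prod CARD('n) A) powr s
    \<le> real CARD('n) powr (real CARD('n) * s) *
      (\<Sum>k\<in>{1..CARD('n)}. \<beta> k powr s * (\<Prod>l\<in>{1..CARD('n)} - {k}. opnorm (A l) powr s))"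
proof -
  let ?n = "CARD('n)"
  define x where "x k = \<beta> k * (\<Prod>l\<in>{1..?n} - {k}. opnorm (A l))" for k
  have \<beta>0: "0 \<le> \<beta> k" for k using \<beta>[of undefined undefined k] by fastforce
  have x0: "0 \<le> x k" for k
    unfolding x_def using \<beta>0 by (intro mult_nonneg_nonneg prod_nonneg) (auto simp: opnorm_nonneg)
  have xs: "x k powr s = \<beta> k powr s * (\<Prod>l\<in>{1..?n} - {k}. opnorm (A l) powr s)" for k
    unfolding x_def by (simp add: powr_mult prod_powr_distrib opnorm_nonneg)
  define G where "G = (\<Sum>k\<in>{1..?n}. x k powr s) powr (1 / s)"
  have G: "1 * x k \<le> G" if "k \<in> {1..?n}" for k
  proof -
    have "x k powr s \<le> (\<Sum>k\<in>{1..?n}. x k powr s)"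
      using that by (intro member_le_sum) auto
    then have "(x k powr s) powr (1 / s) \<le> G"
      unfolding G_def using s by (intro powr_mono2) auto
    then show ?thesis using s x0 by (simp add: powr_powr)
  qed
  have rank: "card {l. \<delta> l < \<delta> j} < ?n" for j
    by (rule psubset_card_mono) auto
  have "\<bar>u i \<bullet> (mat_prod ?n A *v u j)\<bar> \<le> real ?n ^ (?n - 1) * G" for i j
    using mat_prod_entry_bound[OF unit u \<beta> _ _ rank G[unfolded x_def], of i j]
    by (simp add: Suc_le_eq)
  then have "opnorm (mat_prod ?n A) \<le> real ?n * (real ?n ^ (?n - 1) * G)"
    by (rule opnorm_le_entries[OF u])
  also have "\<dots> = real ?n ^ ?n * G"
    by (simp add: power_eq_if)
  finally have "opnorm (mat_prod ?n A) powr s \<le> (real ?n ^ ?n * G) powr s"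
    using s by (intro powr_mono2) (auto simp: opnorm_nonneg)
  also have "\<dots> = real ?n powr (real ?n * s) * (\<Sum>k\<in>{1..?n}. x k powr s)"
    using s by (simp add: powr_mult powr_realpow[symmetric] powr_powr G_def sum_nonneg)
  finally show ?thesis unfolding xs .
qed

section \<open>A basis adapted to a homogeneous function\<close>

text \<open>
  Auerbach's lemma: among all matrices with columns in the compact set of all v with F v \<le> 1
  take T of maximal determinant. By Cramer's rule every T x in this set has coordinates of modulus
  at most 1, since putting T x in place of column k multiplies the determinant by x_k. Homogeneity
  turns this into the estimate for all x.
\<close>
lemma auerbach_basis:
  fixes F :: "real^'n \<Rightarrow> real"
  assumes closed: "closed {v. F v \<le> 1}" and lower: "\<And>v. norm v powr s \<le> F v"
    and hom: "\<And>c v. F (c *\<^sub>R v) = \<bar>c\<bar> powr s * F v" and s: "s > 0"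
  obtains T :: "real^'n^'n" where "det T \<noteq> 0" "\<And>k. F (column k T) \<le> 1"
    "\<And>x k. \<bar>x $ k\<bar> powr s \<le> F (T *v x)"
proof -
  have F0: "F v \<ge> 0" for v using lower[of v] by (rule order_trans[rotated]) simp
  have Fpos: "F v > 0" if "v \<noteq> 0" for v
  proof -
    have "0 < norm v powr s" using that by simp
    also have "\<dots> \<le> F v" by (rule lower)
    finally show ?thesis .
  qed
  have F_zero: "F 0 = 0" using hom[of 0 0] s by simp
  define C where "C = {T :: real^'n^'n. \<forall>k. F (column k T) \<le> 1}"
  have "C = (\<Inter>k. (\<lambda>T. column k T) -` {v. F v \<le> 1})" unfolding C_def by auto
  moreover have "closed ((\<lambda>T :: real^'n^'n. column k T) -` {v. F v \<le> 1})" for k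
    using closed by (rule closed_vimage) (simp add: column_def continuous_intros)
  ultimately have "closed C" by auto
  moreover have "bounded C"
  proof (rule boundedI)
    fix T assume "T \<in> C"
    have "\<bar>T $ i $ j\<bar> \<le> 1" for i j
    proof -
      have "norm (column j T) powr s \<le> 1 powr s"
        using lower[of "column j T"] \<open>T \<in> C\<close> unfolding C_def by (simp add: order_trans)
      then have "norm (column j T) \<le> 1"
        using s powr_less_mono2[of s 1 "norm (column j T)"] by (meson not_le zero_le_one)
      then show ?thesis
        using component_le_norm_cart[of "column j T" i] by (simp add: column_def)
    qed
    then have "(\<Sum>i\<in>UNIV. \<Sum>j\<in>UNIV. \<bar>T $ i $ j\<bar>) \<le> (\<Sum>i\<in>(UNIV::'n set). \<Sum>j\<in>(UNIV::'n set). 1)"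
      by (intro sum_mono)
    moreover have "norm T \<le> (\<Sum>i\<in>UNIV. norm (T $ i))"
      unfolding norm_vec_def by (rule L2_set_le_sum) simp
    moreover have "(\<Sum>i\<in>UNIV. norm (T $ i)) \<le> (\<Sum>i\<in>UNIV. \<Sum>j\<in>UNIV. \<bar>T $ i $ j\<bar>)"
      by (intro sum_mono norm_le_l1_cart)
    ultimately show "norm T \<le> (\<Sum>i\<in>(UNIV::'n set). \<Sum>j\<in>(UNIV::'n set). 1)" by linarith
  qed
  ultimately have compact: "compact C" by (simp add: compact_eq_bounded_closed)
  obtain T0 where T0: "T0 \<in> C" "det T0 \<noteq> 0"
  proof -
    \<comment> \<open>A small multiple of the identity has its columns in the unit ball of F.\<close>
    define M where "M = 1 + (\<Sum>k\<in>UNIV. F (axis k 1))"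
    have M: "F (axis k 1) \<le> M" for k
      unfolding M_def using F0 by (intro order_trans[OF member_le_sum[of k UNIV "\<lambda>k. F (axis k 1)"]]) auto
    have M1: "M \<ge> 1" unfolding M_def using F0 by (simp add: sum_nonneg)
    define c where "c = M powr (- (1 / s))"
    have c: "c > 0" unfolding c_def using M1 by simp
    have cs: "c powr s = 1 / M"
      unfolding c_def powr_powr using s M1 by (simp add: powr_minus_divide)
    have "F (c *\<^sub>R axis k 1) \<le> 1" for k
    proof -
      have "F (c *\<^sub>R axis k 1) = F (axis k 1) / M"
        using c cs unfolding hom by simp
      then show ?thesis using M[of k] M1 by simp
    qed
    moreover have "column k (mat c) = c *\<^sub>R axis k 1" for k :: 'n
      by (auto simp: vec_eq_iff column_def mat_def axis_def)
    ultimately have "mat c \<in> C" unfolding C_def by simp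
    moreover have "det (mat c :: real^'n^'n) \<noteq> 0"
      using c by (subst det_diagonal) (auto simp: mat_def)
    ultimately show ?thesis by (rule that)
  qed
  have "continuous_on C (\<lambda>T. \<bar>det T\<bar>)"
    unfolding det_def by (intro continuous_intros)
  then obtain T where T: "T \<in> C" and max: "\<And>T'. T' \<in> C \<Longrightarrow> \<bar>det T'\<bar> \<le> \<bar>det T\<bar>"
    using continuous_attains_sup[OF compact, of "\<lambda>T. \<bar>det T\<bar>"] T0 by blast
  have detT: "det T \<noteq> 0" using max[OF T0(1)] T0(2) by auto
  have "\<bar>x $ k\<bar> powr s \<le> F (T *v x)" for x k
  proof (cases "T *v x = 0")
    case True
    obtain S where "S ** T = mat 1"
      using detT invertible_det_nz[of T] unfolding invertible_def by auto
    then have "x = S *v (T *v x)" by (simp add: matrix_vector_mul_assoc)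
    then have "x = 0" using True by simp
    then show ?thesis using F0 s by simp
  next
    case False
    define f where "f = F (T *v x)"
    have f: "f > 0" unfolding f_def using False by (rule Fpos)
    define c where "c = f powr (- (1 / s))"
    have c: "c > 0" unfolding c_def using f by simp
    have cs: "c powr s = 1 / f" unfolding c_def powr_powr using s f by (simp add: powr_minus_divide)
    \<comment> \<open>By Cramer's rule, replacing column k by the normalised vector T x multiplies the
      determinant by the corresponding coordinate.\<close>
    define T' :: "real^'n^'n" where "T' = (\<chi> i j. if j = k then (T *v (c *\<^sub>R x)) $ i else T $ i $ j)"
    have "column j T' = (if j = k then c *\<^sub>R (T *v x) else column j T)" for j
      by (auto simp: T'_def column_def vec_eq_iff matrix_vector_mult_scaleR)
    then have "T' \<in> C"
      using T c cs f unfolding C_def by (auto simp: hom f_def)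
    from max[OF this] have "\<bar>(c *\<^sub>R x) $ k * det T\<bar> \<le> \<bar>det T\<bar>"
      unfolding T'_def cramer_lemma .
    then have "c * \<bar>x $ k\<bar> \<le> 1" using detT c by (simp add: abs_mult)
    then have "(c * \<bar>x $ k\<bar>) powr s \<le> 1 powr s"
      using c s by (intro powr_mono2) auto
    then show ?thesis using c cs f by (simp add: powr_mult f_def)
  qed
  with detT T show ?thesis unfolding C_def by (intro that[of T]) auto
qed

text \<open>
  The last two estimates compare F with the Euclidean function |S y|^s in both directions, where S
  inverts an Auerbach matrix T of F. The lower bound for F costs d^(s/2), the passage from the
  maximum of the coordinates to the Euclidean norm; the upper bound costs d^(max s 1 - s/2), by the
  power mean inequality. Since the basis consists of singular vectors of S, a coordinate times its
  scale never exceeds |S y|.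
\<close>
lemma adapted_orthonormal_basis:
  fixes F :: "real^'n \<Rightarrow> real"
  assumes closed: "closed {v. F v \<le> 1}" and lower: "\<And>v. norm v powr s \<le> F v"
    and hom: "\<And>c v. F (c *\<^sub>R v) = \<bar>c\<bar> powr s * F v" and s: "s > 0"
    and sum_le: "\<And>(c :: 'n \<Rightarrow> real) w. F (\<Sum>k\<in>UNIV. c k *\<^sub>R w k)
      \<le> (\<Sum>k\<in>UNIV. \<bar>c k\<bar> powr min s 1) powr (max s 1 - 1) * (\<Sum>k\<in>UNIV. \<bar>c k\<bar> powr min s 1 * F (w k))"
  obtains u :: "'n \<Rightarrow> real^'n" and \<delta> :: "'n \<Rightarrow> real"
  where "\<And>i. norm (u i) = 1" "\<And>y. (\<Sum>i\<in>UNIV. (u i \<bullet> y) *\<^sub>R u i) = y" "\<And>i. \<delta> i > 0"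
    "\<And>i y. (\<delta> i * \<bar>u i \<bullet> y\<bar>) powr s \<le> real CARD('n) powr (s / 2) * F y"
    "\<And>i. F (u i) \<le> real CARD('n) powr (max s 1 - s / 2) * \<delta> i powr s"
proof -
  let ?d = "real CARD('n)"
  let ?t = "min s 1"
  let ?r = "max s 1"
  have d: "?d \<ge> 1" by (simp add: Suc_le_eq)
  have F0: "F v \<ge> 0" for v using lower[of v] by (rule order_trans[rotated]) simp
  obtain T :: "real^'n^'n" where detT: "det T \<noteq> 0" and col: "\<And>k. F (column k T) \<le> 1"
    and coord: "\<And>x k. \<bar>x $ k\<bar> powr s \<le> F (T *v x)"
    using auerbach_basis[OF closed lower hom s] by blast
  then obtain S where ST: "S ** T = mat 1" and TS: "T ** S = mat 1"
    using invertible_det_nz[of T] unfolding invertible_def by auto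
  have TSv: "T *v (S *v y) = y" for y by (simp add: matrix_vector_mul_assoc TS)
  obtain u :: "'n \<Rightarrow> real^'n" where u: "\<And>i. norm (u i) = 1" "\<And>i j. i \<noteq> j \<Longrightarrow> u i \<bullet> u j = 0"
    "\<And>i j. i \<noteq> j \<Longrightarrow> (S *v u i) \<bullet> (S *v u j) = 0"
    "\<And>y. (\<Sum>i\<in>UNIV. (u i \<bullet> y) *\<^sub>R u i) = y"
    using orthonormal_basis_orthogonal_images[of S] by blast
  define \<delta> where "\<delta> i = norm (S *v u i)" for i
  have \<delta>: "\<delta> i > 0" for i
  proof -
    have "S *v u i \<noteq> 0" using TSv[of "u i"] u(1)[of i] by (metis matrix_vector_mult_0_right norm_zero zero_neq_one)
    then show ?thesis unfolding \<delta>_def by simp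
  qed
  have norm_sq: "(norm x powr s) = (\<Sum>k\<in>UNIV. (x $ k)\<^sup>2) powr (s / 2)" for x :: "real^'n"
  proof -
    have "norm x = (\<Sum>k\<in>UNIV. (x $ k)\<^sup>2) powr (1 / 2)"
      unfolding norm_vec_def L2_set_def by (simp add: powr_half_sqrt sum_nonneg)
    then show ?thesis by (simp add: powr_powr)
  qed
  have lower_S: "norm x powr s \<le> ?d powr (s / 2) * F (T *v x)" for x
  proof -
    have "(x $ k)\<^sup>2 \<le> F (T *v x) powr (2 / s)" for k
    proof -
      have "(\<bar>x $ k\<bar> powr s) powr (2 / s) \<le> F (T *v x) powr (2 / s)"
        using s coord by (intro powr_mono2) auto
      then show ?thesis using s by (simp add: powr_powr powr_numeral)
    qed
    then have "(\<Sum>k\<in>UNIV. (x $ k)\<^sup>2) \<le> (\<Sum>k\<in>(UNIV::'n set). F (T *v x) powr (2 / s))"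
      by (intro sum_mono)
    then have "norm x powr s \<le> (?d * F (T *v x) powr (2 / s)) powr (s / 2)"
      unfolding norm_sq using s by (intro powr_mono2) (auto simp: sum_nonneg)
    also have "\<dots> = ?d powr (s / 2) * F (T *v x)"
      using s F0 by (simp add: powr_mult powr_powr)
    finally show ?thesis .
  qed
  have upper_S: "F (T *v x) \<le> ?d powr (?r - s / 2) * norm x powr s" for x
  proof -
    define Q where "Q = (\<Sum>k\<in>UNIV. \<bar>x $ k\<bar> powr ?t)"
    have Q0: "Q \<ge> 0" unfolding Q_def by (intro sum_nonneg) simp
    have "T *v x = (\<Sum>k\<in>UNIV. (x $ k) *\<^sub>R column k T)"
      by (simp add: matrix_mult_sum scalar_mult_eq_scaleR)
    then have "F (T *v x) \<le> Q powr (?r - 1) * (\<Sum>k\<in>UNIV. \<bar>x $ k\<bar> powr ?t * F (column k T))"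
      unfolding Q_def using sum_le[of "\<lambda>k. x $ k" "\<lambda>k. column k T"] by simp
    also have "\<dots> \<le> Q powr (?r - 1) * (\<Sum>k\<in>UNIV. \<bar>x $ k\<bar> powr ?t * 1)"
      using col by (intro mult_left_mono sum_mono) auto
    also have "\<dots> = Q powr ?r"
      using Q0 by (cases "Q = 0") (simp_all add: Q_def[symmetric] powr_diff)
    also have "\<dots> \<le> (?d powr (1 - ?t / 2) * (\<Sum>k\<in>UNIV. (x $ k)\<^sup>2) powr (?t / 2)) powr ?r"
    proof (rule powr_mono2)
      have "Q = (\<Sum>k\<in>UNIV. ((x $ k)\<^sup>2) powr (?t / 2))"
        unfolding Q_def
      proof (intro sum.cong refl)
        fix k
        have "(x $ k)\<^sup>2 = \<bar>x $ k\<bar> powr 2" by simp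
        then show "\<bar>x $ k\<bar> powr ?t = ((x $ k)\<^sup>2) powr (?t / 2)" by (simp only: powr_powr) simp
      qed
      also have "\<dots> \<le> ?d powr (1 - ?t / 2) * (\<Sum>k\<in>UNIV. (x $ k)\<^sup>2) powr (?t / 2)"
        using s by (intro sum_powr_le_power_mean) auto
      finally show "Q \<le> ?d powr (1 - ?t / 2) * (\<Sum>k\<in>UNIV. (x $ k)\<^sup>2) powr (?t / 2)" .
    qed (use Q0 in auto)
    also have "\<dots> = ?d powr ((1 - ?t / 2) * ?r) * (\<Sum>k\<in>UNIV. (x $ k)\<^sup>2) powr (?t / 2 * ?r)"
      by (simp only: powr_mult powr_powr)
    also have "?t / 2 * ?r = s / 2" by (auto simp: min_def max_def)
    also have "(1 - ?t / 2) * ?r = ?r - s / 2" by (auto simp: min_def max_def algebra_simps)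
    finally show ?thesis unfolding norm_sq .
  qed
  have coord_le: "\<delta> i * \<bar>u i \<bullet> y\<bar> \<le> norm (S *v y)" for i y
  proof -
    have "S *v y = (\<Sum>l\<in>UNIV. (u l \<bullet> y) *\<^sub>R (S *v u l))"
      by (subst (1) u(4)[of y, symmetric])
        (simp add: matrix_vector_mult_scaleR linear_sum[OF matrix_vector_mul_linear])
    then have "(S *v y) \<bullet> (S *v u i) = (\<Sum>l\<in>UNIV. (u l \<bullet> y) * ((S *v u l) \<bullet> (S *v u i)))"
      by (simp add: inner_sum_left)
    also have "\<dots> = (\<Sum>l\<in>UNIV. if l = i then (u i \<bullet> y) * (\<delta> i)\<^sup>2 else 0)"
      using u(3) by (intro sum.cong refl) (auto simp: \<delta>_def power2_norm_eq_inner)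
    finally have "(S *v y) \<bullet> (S *v u i) = (u i \<bullet> y) * (\<delta> i)\<^sup>2" by simp
    then have "\<bar>u i \<bullet> y\<bar> * (\<delta> i)\<^sup>2 \<le> norm (S *v y) * \<delta> i"
      using Cauchy_Schwarz_ineq2[of "S *v y" "S *v u i"] by (simp add: abs_mult \<delta>_def)
    then show ?thesis using \<delta>[of i] by (simp add: power2_eq_square mult_ac)
  qed
  show ?thesis
  proof (rule that[OF u(1) u(4) \<delta>])
    fix i y
    have "(\<delta> i * \<bar>u i \<bullet> y\<bar>) powr s \<le> norm (S *v y) powr s"
      using s \<delta>[of i] coord_le by (intro powr_mono2) auto
    also have "\<dots> \<le> ?d powr (s / 2) * F y"
      using lower_S[of "S *v y"] by (simp add: TSv)
    finally show "(\<delta> i * \<bar>u i \<bullet> y\<bar>) powr s \<le> ?d powr (s / 2) * F y" .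
  next
    fix i
    show "F (u i) \<le> ?d powr (?r - s / 2) * \<delta> i powr s"
      using upper_S[of "S *v u i"] by (simp add: TSv \<delta>_def)
  qed
qed

section \<open>Fekete's lemma\<close>

lemma root_elog_le_iff:
  assumes "n \<ge> 1"
  shows "ereal (1 / real n) * elog y \<le> ereal c \<longleftrightarrow> y \<le> ennreal (exp (c * real n))"
proof (cases y)
  case (real r)
  show ?thesis
  proof (cases "r = 0")
    case True
    then show ?thesis using real assms by (simp add: elog_def)
  next
    case False
    then have r: "r > 0" using real by simp
    have "ln r / real n \<le> c \<longleftrightarrow> ln r \<le> c * real n"
      using assms by (simp add: divide_le_eq)
    also have "\<dots> \<longleftrightarrow> r \<le> exp (c * real n)" using r by (metis exp_gt_zero exp_ln ln_exp ln_le_cancel_iff)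
    finally show ?thesis using r real by (simp add: elog_def)
  qed
next
  case top
  then show ?thesis using assms by (simp add: elog_def top_unique)
qed

lemma submultiplicative_mult_add_le:
  fixes x :: "nat \<Rightarrow> ennreal"
  assumes "\<And>m n. x (m + n) \<le> x m * x n"
  shows "x (q * m + r) \<le> x m ^ q * x r"
proof (induction q)
  case (Suc q)
  have "x (Suc q * m + r) \<le> x m * x (q * m + r)"
    using assms[of m "q * m + r"] by (simp add: add.assoc)
  also have "\<dots> \<le> x m * (x m ^ q * x r)" by (intro mult_left_mono Suc.IH) simp
  finally show ?case by (simp add: mult.assoc)
qed simp

text \<open>
  The subadditivity argument of Fekete: write n = q m + r with r < m, so that x n is at most
  (x m)^q times a bound R for the finitely many remainders. The correction is of order 1 / n.
  Working with a real bound c for the m-th root avoids logarithms of vanishing terms.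
\<close>
lemma limsup_root_elog_le:
  fixes x :: "nat \<Rightarrow> ennreal"
  assumes fin: "\<And>n. x n < \<infinity>" and sub: "\<And>m n. x (m + n) \<le> x m * x n"
    and m: "m \<ge> 1" and c: "ereal (1 / real m) * elog (x m) \<le> ereal c"
  shows "limsup (\<lambda>n. ereal (1 / real n) * elog (x n)) \<le> ereal c"
proof -
  \<comment> \<open>The summand 1 keeps ln R defined when all remainders vanish.\<close>
  define R where "R = 1 + (\<Sum>r<m. enn2real (x r))"
  have R1: "R \<ge> 1" unfolding R_def by (simp add: sum_nonneg)
  have xR: "x r \<le> ennreal R" if "r < m" for r
  proof -
    have "enn2real (x r) \<le> (\<Sum>r<m. enn2real (x r))"
      using that by (intro member_le_sum) auto
    then have "ennreal (enn2real (x r)) \<le> ennreal R"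
      unfolding R_def by (intro ennreal_leI) simp
    then show ?thesis using fin[of r] by simp
  qed
  define D where "D = \<bar>c\<bar> * real m + ln R"
  have bound: "ereal (1 / real n) * elog (x n) \<le> ereal (c + D / real n)" if n: "n \<ge> 1" for n
  proof -
    define q r where "q = n div m" and "r = n mod m"
    have n_eq: "n = q * m + r" and r: "r < m" using m by (simp_all add: q_def r_def)
    have "x n \<le> x m ^ q * x r" unfolding n_eq by (rule submultiplicative_mult_add_le[OF sub])
    also have "\<dots> \<le> ennreal (exp (c * real m)) ^ q * ennreal R"
      using c unfolding root_elog_le_iff[OF m] by (intro mult_mono power_mono xR r) auto
    also have "\<dots> = ennreal (exp (c * real m * real q) * R)"
      using R1 by (simp add: ennreal_power ennreal_mult exp_of_nat_mult[symmetric] mult.commute)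
    also have "\<dots> \<le> ennreal (exp ((c + D / real n) * real n))"
    proof (rule ennreal_leI)
      have "c * real n = c * real m * real q + c * real r"
        unfolding n_eq by (simp add: algebra_simps)
      moreover have "\<bar>c * real r\<bar> \<le> \<bar>c\<bar> * real m"
        unfolding abs_mult using r by (intro mult_left_mono) auto
      ultimately have "c * real m * real q + ln R \<le> (c + D / real n) * real n"
      proof -
        have "(c + D / real n) * real n = c * real n + D" using n by (simp add: distrib_right)
        with \<open>c * real n = _\<close> \<open>\<bar>c * real r\<bar> \<le> _\<close> show ?thesis unfolding D_def by linarith
      qed
      then have "exp (c * real m * real q + ln R) \<le> exp ((c + D / real n) * real n)" by simp
      then show "exp (c * real m * real q) * R \<le> exp ((c + D / real n) * real n)"
        using R1 by (simp add: exp_add)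
    qed
    finally show ?thesis unfolding root_elog_le_iff[OF n] .
  qed
  have "(\<lambda>n. c + D / real n) \<longlonglongrightarrow> c + 0"
    by (intro tendsto_intros lim_const_over_n)
  then have "limsup (\<lambda>n. ereal (c + D / real n)) = ereal c"
    by (intro lim_imp_Limsup) (simp_all add: lim_ereal)
  moreover have "limsup (\<lambda>n. ereal (1 / real n) * elog (x n)) \<le> limsup (\<lambda>n. ereal (c + D / real n))"
    by (rule Limsup_mono) (auto simp: eventually_sequentially intro!: exI[of _ 1] bound)
  ultimately show ?thesis by simp
qed

lemma fekete_root_elog:
  fixes x :: "nat \<Rightarrow> ennreal"
  assumes fin: "\<And>n. x n < \<infinity>" and sub: "\<And>m n. x (m + n) \<le> x m * x n"
  shows "convergent (\<lambda>n. ereal (1 / real n) * elog (x n))"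
proof -
  let ?b = "\<lambda>n. ereal (1 / real n) * elog (x n)"
  have "limsup ?b \<le> ?b m" if "m \<ge> 1" for m
    using limsup_root_elog_le[OF fin sub that] by (rule ereal_le_real)
  then have "limsup ?b \<le> liminf ?b"
    by (intro Liminf_bounded) (auto simp: eventually_sequentially)
  then have "liminf ?b = limsup ?b"
    using Liminf_le_Limsup[of sequentially ?b] by (simp add: antisym)
  then have "?b \<longlonglongrightarrow> limsup ?b" by (simp add: tendsto_iff_Liminf_eq_Limsup)
  then show ?thesis by (rule convergentI)
qed

lemma exists_le_power_if_eexp_less:
  fixes x :: "nat \<Rightarrow> ennreal"
  assumes lim: "(\<lambda>n. ereal (1 / real n) * elog (x n)) \<longlonglongrightarrow> L" and less: "eexp L < ennreal a"
  shows "\<exists>n\<ge>1. x n \<le> ennreal (a ^ n)"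
proof -
  have a: "a > 0" using less by (metis ennreal_neg not_less not_less_zero)
  have "L < ereal (ln a)"
  proof (cases L)
    case (real l)
    then have "exp l < a" using less a by (simp add: eexp_def ennreal_less_iff)
    then have "l < ln a" using a by (metis exp_gt_zero exp_less_mono exp_ln linorder_neqE_linordered_idom not_less_iff_gr_or_eq)
    then show ?thesis using real by simp
  qed (use less in \<open>simp_all add: eexp_def\<close>)
  then have "eventually (\<lambda>n. ereal (1 / real n) * elog (x n) < ereal (ln a)) sequentially"
    using lim by (rule order_tendstoD(2)[rotated])
  then have "eventually (\<lambda>n. n \<ge> 1 \<and> ereal (1 / real n) * elog (x n) < ereal (ln a)) sequentially"
    using eventually_ge_at_top[of 1] by eventually_elim simp
  then obtain n where n: "n \<ge> 1" "ereal (1 / real n) * elog (x n) < ereal (ln a)"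
    by (metis (mono_tags, lifting) eventually_sequentially order_refl)
  then have "x n \<le> ennreal (exp (ln a * real n))"
    unfolding root_elog_le_iff[OF n(1), symmetric] by simp
  also have "exp (ln a * real n) = a ^ n"
    using a by (simp add: exp_of_nat2_mult)
  finally show ?thesis using n(1) by blast
qed

section \<open>Removing the zero matrix\<close>

text \<open>
  The product measure has the expected values on boxes as soon as some measure does. For a density
  with values in [0, \<infinity>] of a \<sigma>-finite measure N such a measure is the density of the product of
  N with respect to the product of the densities. With infinite values of the density this covers
  measures that are not \<sigma>-finite.
\<close>
lemma emeasure_PiM_density_box:
  fixes f :: "'b \<Rightarrow> ennreal"
  assumes N: "sigma_finite_measure N" and f [measurable]: "f \<in> borel_measurable N"
    and I: "finite I" and A: "\<And>i. i \<in> I \<Longrightarrow> A i \<in> sets N"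
  shows "emeasure (PiM I (\<lambda>_. density N f)) (Pi\<^sub>E I A) = (\<Prod>i\<in>I. emeasure (density N f) (A i))"
proof -
  interpret N: sigma_finite_measure N by fact
  interpret P: product_sigma_finite "\<lambda>_. N" by standard
  let ?M = "\<lambda>_ :: 'a. density N f"
  let ?D = "density (PiM I (\<lambda>_. N)) (\<lambda>\<omega>. \<Prod>i\<in>I. f (\<omega> i))"
  have sets_eq: "sets (PiM I ?M) = sets (PiM I (\<lambda>_. N))"
    by (rule sets_PiM_cong) auto
  have D: "emeasure ?D (Pi\<^sub>E I E) = (\<Prod>i\<in>I. emeasure (density N f) (E i))"
    if E: "\<And>i. i \<in> I \<Longrightarrow> E i \<in> sets N" for E
  proof -
    have "emeasure ?D (Pi\<^sub>E I E) = (\<integral>\<^sup>+\<omega>. (\<Prod>i\<in>I. f (\<omega> i)) * indicator (Pi\<^sub>E I E) \<omega> \<partial>PiM I (\<lambda>_. N))"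
      using E I by (intro emeasure_density sets_PiM_I_finite) auto
    also have "\<dots> = (\<integral>\<^sup>+\<omega>. (\<Prod>i\<in>I. f (\<omega> i) * indicator (E i) (\<omega> i)) \<partial>PiM I (\<lambda>_. N))"
    proof (rule nn_integral_cong)
      fix \<omega> assume \<omega>: "\<omega> \<in> space (PiM I (\<lambda>_. N))"
      have "indicator (Pi\<^sub>E I E) \<omega> = (\<Prod>i\<in>I. indicator (E i) (\<omega> i) :: ennreal)"
      proof (cases "\<omega> \<in> Pi\<^sub>E I E")
        case False
        then obtain i where "i \<in> I" "\<omega> i \<notin> E i"
          using \<omega> by (auto simp: space_PiM PiE_iff)
        then show ?thesis using False I by (auto simp: prod_zero_iff intro!: bexI[of _ i])
      qed (auto simp: PiE_iff)
      then show "(\<Prod>i\<in>I. f (\<omega> i)) * indicator (Pi\<^sub>E I E) \<omega> = (\<Prod>i\<in>I. f (\<omega> i) * indicator (E i) (\<omega> i))"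
        by (simp add: prod.distrib)
    qed
    also have "\<dots> = (\<Prod>i\<in>I. \<integral>\<^sup>+x. f x * indicator (E i) x \<partial>N)"
      using E I by (intro P.product_nn_integral_prod) auto
    also have "\<dots> = (\<Prod>i\<in>I. emeasure (density N f) (E i))"
      using E by (intro prod.cong refl emeasure_density[symmetric]) auto
    finally show ?thesis .
  qed
  have "emeasure (PiM I ?M) (prod_emb I ?M I (Pi\<^sub>E I A)) = (\<Prod>i\<in>I. emeasure (density N f) (A i))"
  proof (subst emeasure_extend_measure_Pair[OF PiM_def])
    fix J E assume "(J \<noteq> {} \<or> I = {}) \<and> finite J \<and> J \<subseteq> I \<and> E \<in> (\<Pi> j\<in>J. sets (density N f))"
    then have J: "finite J" "J \<subseteq> I" and E: "\<And>j. j \<in> J \<Longrightarrow> E j \<in> sets N" by auto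
    let ?p = "prod_emb I ?M J (Pi\<^sub>E J E)"
    have p: "?p = (\<Pi>\<^sub>E i\<in>I. if i \<in> J then E i else space N)"
      using prod_emb_PiE[OF J(2), of E ?M] E[THEN sets.sets_into_space]
      unfolding space_density by simp
    have "emeasure ?D ?p = (\<Prod>i\<in>I. emeasure (density N f) (if i \<in> J then E i else space N))"
      unfolding p using E by (intro D) auto
    also have "\<dots> = (\<Prod>i\<in>J \<union> {i \<in> I. emeasure (density N f) (space (density N f)) \<noteq> 1}.
        if i \<in> J then emeasure (density N f) (E i) else emeasure (density N f) (space (density N f)))"
      using I J by (intro prod.mono_neutral_cong_right) auto
    finally show "emeasure ?D ?p = \<dots>" .
    show "?p \<in> Pow (\<Pi>\<^sub>E i\<in>I. space (density N f))"
      unfolding p using E[THEN sets.sets_into_space] by (auto simp: PiE_iff split: if_splits) blast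
  next
    show "positive (sets (PiM I ?M)) (emeasure ?D)" "countably_additive (sets (PiM I ?M)) (emeasure ?D)"
      using emeasure_positive[of ?D] emeasure_countably_additive[of ?D] by (simp_all add: sets_eq)
  next
    show "(I \<noteq> {} \<or> I = {}) \<and> finite I \<and> I \<subseteq> I \<and> A \<in> (\<Pi> j\<in>I. sets (density N f))"
      using I A by auto
  qed (auto intro!: prod.cong)
  then show ?thesis
    using A by (subst (asm) prod_emb_PiE_same_index) (auto dest: sets.sets_into_space)
qed

definition opnorm_tail :: "real \<Rightarrow> nat \<Rightarrow> (real^'n^'n) set" where
  "opnorm_tail s k = {A. 1 \<le> of_nat k * ennreal (opnorm A powr s)}"

lemma opnorm_tail_borel [measurable]: "opnorm_tail s k \<in> sets borel"
proof -
  have "{A \<in> space (borel :: (real^'n^'n) measure). 1 \<le> of_nat k * ennreal (opnorm A powr s)} \<in> sets borel"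
    by measurable
  then show ?thesis unfolding opnorm_tail_def by (simp only: space_borel UNIV_I simp_thms)
qed

lemma emeasure_opnorm_tail_finite:
  assumes \<mu>: "sets \<mu> = sets borel" and fin: "norm_moment \<mu> s < \<infinity>"
  shows "emeasure \<mu> (opnorm_tail s k) < \<infinity>"
proof -
  have [measurable_cong]: "sets \<mu> = sets borel" by fact
  have sp: "space \<mu> = UNIV" using sets_eq_imp_space_eq[OF \<mu>] by simp
  have "emeasure \<mu> {A \<in> space \<mu>. 1 \<le> of_nat k * ennreal (opnorm A powr s)}
      \<le> of_nat k * (\<integral>\<^sup>+A. ennreal (opnorm A powr s) * indicator (space \<mu>) A \<partial>\<mu>)"
    by (intro nn_integral_Markov_inequality) measurable
  also have "\<dots> = of_nat k * norm_moment \<mu> s"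
    unfolding norm_moment_def by (simp add: sp)
  also have "\<dots> < \<infinity>" using fin by (simp add: ennreal_mult_less_top of_nat_less_top)
  finally show ?thesis unfolding opnorm_tail_def by (simp only: sp UNIV_I simp_thms)
qed

lemma sigma_finite_if_tails_finite:
  fixes N :: "(real^'n^'n) measure"
  assumes N: "sets N = sets borel" and zero: "emeasure N {0} < \<infinity>"
    and tail: "\<And>k. emeasure N (opnorm_tail s k) < \<infinity>"
  shows "sigma_finite_measure N"
proof
  have sp: "space N = UNIV" using sets_eq_imp_space_eq[OF N] by simp
  have "A \<in> {0} \<union> (\<Union>k. opnorm_tail s k)" for A :: "real^'n^'n"
  proof (cases "A = 0")
    case False
    then have pos: "opnorm A powr s > 0" by (simp add: opnorm_eq_0_iff)
    obtain k :: nat where "1 < of_nat k * (opnorm A powr s)"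
      using reals_Archimedean3[OF pos] by blast
    then have "ennreal 1 \<le> ennreal (of_nat k * opnorm A powr s)" by (intro ennreal_leI) simp
    also have "\<dots> = of_nat k * ennreal (opnorm A powr s)"
      by (simp add: ennreal_mult ennreal_of_nat_eq_real_of_nat)
    finally have "A \<in> opnorm_tail s k" by (simp add: opnorm_tail_def)
    then show ?thesis by blast
  qed simp
  then have "\<Union>(insert {0} (range (opnorm_tail s))) = space N" unfolding sp by blast
  moreover have "insert {0} (range (opnorm_tail s)) \<subseteq> sets N"
    using opnorm_tail_borel by (auto simp: N)
  moreover have "\<forall>a\<in>insert {0} (range (opnorm_tail s)). emeasure N a \<noteq> \<infinity>"
    using zero tail by (auto simp: less_top)
  ultimately show "\<exists>S. countable S \<and> S \<subseteq> sets N \<and> \<Union>S = space N \<and> (\<forall>a\<in>S. emeasure N a \<noteq> \<infinity>)"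
    by (intro exI[of _ "insert {0} (range (opnorm_tail s))"]) simp
qed

definition nonzero_part :: "(real^'n^'n) measure \<Rightarrow> (real^'n^'n) measure" where
  "nonzero_part \<mu> = density \<mu> (indicator (- {0}))"

lemma sets_nonzero_part [simp]: "sets (nonzero_part \<mu>) = sets \<mu>"
  unfolding nonzero_part_def by simp

lemma emeasure_nonzero_part:
  assumes "sets \<mu> = sets borel" "X \<in> sets borel"
  shows "emeasure (nonzero_part \<mu>) X = emeasure \<mu> (X - {0})"
proof -
  have [measurable_cong]: "sets \<mu> = sets borel" by fact
  have "emeasure (nonzero_part \<mu>) X = (\<integral>\<^sup>+A. indicator (- {0}) A * indicator X A \<partial>\<mu>)"
    unfolding nonzero_part_def using assms by (intro emeasure_density) auto
  also have "\<dots> = (\<integral>\<^sup>+A. indicator (X - {0}) A \<partial>\<mu>)"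
    by (intro nn_integral_cong) (auto split: split_indicator)
  also have "\<dots> = emeasure \<mu> (X - {0})" using assms by simp
  finally show ?thesis .
qed

lemma sigma_finite_nonzero_part:
  assumes \<mu>: "sets \<mu> = sets borel" and fin: "norm_moment \<mu> s < \<infinity>"
  shows "sigma_finite_measure (nonzero_part \<mu>)"
proof (rule sigma_finite_if_tails_finite)
  fix k
  have "emeasure (nonzero_part \<mu>) (opnorm_tail s k) \<le> emeasure \<mu> (opnorm_tail s k)"
    using \<mu> by (simp add: emeasure_nonzero_part emeasure_mono)
  also have "\<dots> < \<infinity>" by (rule emeasure_opnorm_tail_finite[OF assms])
  finally show "emeasure (nonzero_part \<mu>) (opnorm_tail s k) < \<infinity>" .
qed (use \<mu> in \<open>simp_all add: emeasure_nonzero_part\<close>)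

text \<open>
  Give the zero matrix mass 1 instead of its possibly infinite mass; the density f restores it.
\<close>
lemma density_of_sigma_finite:
  fixes \<mu> :: "(real^'n^'n) measure"
  assumes \<mu>: "sets \<mu> = sets borel" and fin: "norm_moment \<mu> s < \<infinity>"
  obtains N and f :: "real^'n^'n \<Rightarrow> ennreal"
  where "sigma_finite_measure N" "f \<in> borel_measurable N" "\<mu> = density N f"
proof -
  have [measurable_cong]: "sets \<mu> = sets borel" by fact
  define D :: "(real^'n^'n) measure" where "D = distr (count_space {()}) borel (\<lambda>_. 0)"
  have D: "emeasure D X = indicator X 0" if "X \<in> sets borel" for X
    unfolding D_def using that
    by (subst emeasure_distr) (auto simp: emeasure_count_space_finite split: split_indicator)
  have sets_D: "sets D = sets borel" unfolding D_def by simp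
  define m where "m X = emeasure (nonzero_part \<mu>) X + emeasure D X" for X
  define N where "N = measure_of UNIV (sets (borel :: (real^'n^'n) measure)) m"
  have sets_N: "sets N = sets borel" unfolding N_def
    using sets.sets_measure_of_eq[of "borel :: (real^'n^'n) measure"] by simp
  have N: "emeasure N X = emeasure \<mu> (X - {0}) + indicator X 0" if X: "X \<in> sets borel" for X
  proof -
    have "emeasure N X = m X" unfolding N_def
    proof (rule emeasure_measure_of_sigma)
      show "sigma_algebra UNIV (sets (borel :: (real^'n^'n) measure))"
        using sets.sigma_algebra_axioms[of "borel :: (real^'n^'n) measure"] by simp
      show "positive (sets (borel :: (real^'n^'n) measure)) m"
        by (simp add: positive_def m_def)
      show "countably_additive (sets (borel :: (real^'n^'n) measure)) m"
      proof (rule countably_additiveI)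
        fix A :: "nat \<Rightarrow> (real^'n^'n) set"
        assume A: "range A \<subseteq> sets borel" "disjoint_family A"
        have "(\<Sum>i. m (A i)) = (\<Sum>i. emeasure (nonzero_part \<mu>) (A i)) + (\<Sum>i. emeasure D (A i))"
          unfolding m_def by (intro suminf_add[symmetric] summableI)
        also have "\<dots> = m (\<Union>i. A i)"
          unfolding m_def using A \<mu> sets_D by (simp add: suminf_emeasure)
        finally show "(\<Sum>i. m (A i)) = m (\<Union>i. A i)" .
      qed
    qed (fact X)
    then show ?thesis unfolding m_def by (simp add: emeasure_nonzero_part \<mu> X D)
  qed
  have [measurable_cong]: "sets N = sets borel" by (fact sets_N)
  define f :: "real^'n^'n \<Rightarrow> ennreal" where "f A = (if A = 0 then emeasure \<mu> {0} else 1)" for A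
  have f [measurable]: "f \<in> borel_measurable N" unfolding f_def by measurable
  have "sigma_finite_measure N"
  proof (rule sigma_finite_if_tails_finite[OF sets_N])
    show "emeasure N {0} < \<infinity>" by (simp add: N)
    fix k
    have "emeasure N (opnorm_tail s k) \<le> emeasure \<mu> (opnorm_tail s k) + 1"
      unfolding N[OF opnorm_tail_borel] using \<mu>
      by (intro add_mono emeasure_mono) (auto split: split_indicator)
    also have "\<dots> < \<infinity>" using emeasure_opnorm_tail_finite[OF assms, of k] by simp
    finally show "emeasure N (opnorm_tail s k) < \<infinity>" .
  qed
  moreover have "\<mu> = density N f"
  proof (rule measure_eqI)
    show "sets \<mu> = sets (density N f)" using \<mu> sets_N by simp
    fix X assume "X \<in> sets \<mu>"
    then have X [measurable]: "X \<in> sets borel" using \<mu> by simp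
    have "emeasure (density N f) X = (\<integral>\<^sup>+A. f A * indicator X A \<partial>N)"
      using X sets_N by (intro emeasure_density) auto
    also have "\<dots> = (\<integral>\<^sup>+A. emeasure \<mu> {0} * indicator (X \<inter> {0}) A + indicator (X - {0}) A \<partial>N)"
      by (intro nn_integral_cong) (auto simp: f_def split: split_indicator)
    also have "\<dots> = emeasure \<mu> {0} * emeasure N (X \<inter> {0}) + emeasure N (X - {0})"
      using X sets_N by (subst nn_integral_add) (auto simp: nn_integral_cmult_indicator)
    also have "\<dots> = emeasure \<mu> {0} * indicator X 0 + emeasure \<mu> (X - {0})"
    proof -
      have "X \<inter> {0} - {0} = {}" "X - {0} - {0} = X - {0}" by auto
      then show ?thesis by (simp add: N split: split_indicator)
    qed
    also have "emeasure \<mu> {0} * indicator X 0 = emeasure \<mu> (X \<inter> {0})"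
      by (auto split: split_indicator)
    also have "emeasure \<mu> (X \<inter> {0}) + emeasure \<mu> (X - {0}) = emeasure \<mu> ((X \<inter> {0}) \<union> (X - {0}))"
      using X \<mu> by (intro plus_emeasure) auto
    also have "(X \<inter> {0}) \<union> (X - {0}) = X" by auto
    finally show "emeasure \<mu> X = emeasure (density N f) X" by simp
  qed
  ultimately show ?thesis using f that by blast
qed

text \<open>
  Both sides agree on boxes, and the left-hand side is determined by its values on boxes because
  \<^const>\<open>nonzero_part\<close> is \<sigma>-finite.
\<close>
lemma PiM_nonzero_part:
  fixes \<mu> :: "(real^'n^'n) measure"
  assumes \<mu>: "sets \<mu> = sets borel" and fin: "norm_moment \<mu> s < \<infinity>" and I: "finite I"
  shows "PiM I (\<lambda>_. nonzero_part \<mu>) = density (PiM I (\<lambda>_. \<mu>)) (indicator (\<Pi>\<^sub>E i\<in>I. - {0}))"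
proof -
  obtain N and f :: "real^'n^'n \<Rightarrow> ennreal"
    where N: "sigma_finite_measure N" "f \<in> borel_measurable N" "\<mu> = density N f"
    using density_of_sigma_finite[OF \<mu> fin] by blast
  have sets_N: "sets N = sets \<mu>" using N(3) by simp
  interpret nz: sigma_finite_measure "nonzero_part \<mu>" by (rule sigma_finite_nonzero_part[OF \<mu> fin])
  interpret P: product_sigma_finite "\<lambda>_. nonzero_part \<mu>" by standard
  have Z: "(\<Pi>\<^sub>E i\<in>I. - {0}) \<in> sets (PiM I (\<lambda>_. \<mu>))"
    using I \<mu> by (intro sets_PiM_I_finite) auto
  show ?thesis
  proof (rule P.PiM_eqI[OF I, symmetric])
    show "sets (density (PiM I (\<lambda>_. \<mu>)) (indicator (\<Pi>\<^sub>E i\<in>I. - {0}))) = sets (PiM I (\<lambda>_. nonzero_part \<mu>))"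
      by (simp, intro sets_PiM_cong) auto
    fix A assume A: "\<And>i. i \<in> I \<Longrightarrow> A i \<in> sets (nonzero_part \<mu>)"
    then have A': "Pi\<^sub>E I A \<in> sets (PiM I (\<lambda>_. \<mu>))" using I by (intro sets_PiM_I_finite) auto
    have "emeasure (density (PiM I (\<lambda>_. \<mu>)) (indicator (\<Pi>\<^sub>E i\<in>I. - {0}))) (Pi\<^sub>E I A)
        = (\<integral>\<^sup>+\<omega>. indicator (\<Pi>\<^sub>E i\<in>I. - {0}) \<omega> * indicator (Pi\<^sub>E I A) \<omega> \<partial>PiM I (\<lambda>_. \<mu>))"
      using A' Z by (intro emeasure_density) auto
    also have "\<dots> = (\<integral>\<^sup>+\<omega>. indicator (\<Pi>\<^sub>E i\<in>I. A i - {0}) \<omega> \<partial>PiM I (\<lambda>_. \<mu>))"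
      by (intro nn_integral_cong) (auto simp: PiE_iff split: split_indicator)
    also have "\<dots> = emeasure (PiM I (\<lambda>_. \<mu>)) (\<Pi>\<^sub>E i\<in>I. A i - {0})"
      using A I \<mu> by (intro nn_integral_indicator sets_PiM_I_finite) auto
    also have "\<dots> = (\<Prod>i\<in>I. emeasure \<mu> (A i - {0}))"
      unfolding N(3) using A \<mu> sets_N I by (intro emeasure_PiM_density_box N) auto
    also have "\<dots> = (\<Prod>i\<in>I. emeasure (nonzero_part \<mu>) (A i))"
      using A \<mu> by (intro prod.cong refl emeasure_nonzero_part[symmetric]) auto
    finally show "emeasure (density (PiM I (\<lambda>_. \<mu>)) (indicator (\<Pi>\<^sub>E i\<in>I. - {0}))) (Pi\<^sub>E I A)
        = (\<Prod>i\<in>I. emeasure (nonzero_part \<mu>) (A i))" .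
  qed
qed

lemma mat_prod_eq_0: "k \<in> {1..n} \<Longrightarrow> A k = 0 \<Longrightarrow> mat_prod n A = 0"
  by (induction n) (auto simp: le_Suc_eq)

lemma norm_moment_mat_conv:
  fixes \<mu> :: "(real^'n^'n) measure"
  assumes "sets \<mu> = sets borel"
  shows "norm_moment (mat_conv \<mu> n) s = (\<integral>\<^sup>+A. ennreal (opnorm (mat_prod n A) powr s) \<partial>PiM {1..n} (\<lambda>_. \<mu>))"
  unfolding norm_moment_def mat_conv_def
  by (rule nn_integral_distr[OF measurable_mat_prod[OF assms]]) measurable

lemma norm_moment_nonzero_part:
  assumes "sets \<mu> = sets borel" "s > 0"
  shows "norm_moment (nonzero_part \<mu>) s = norm_moment \<mu> s"
proof -
  have [measurable_cong]: "sets \<mu> = sets borel" by fact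
  show ?thesis unfolding norm_moment_def nonzero_part_def
    using assms by (subst nn_integral_density)
      (auto intro!: nn_integral_cong simp: opnorm_zero split: split_indicator)
qed

lemma norm_moment_mat_conv_nonzero_part:
  fixes \<mu> :: "(real^'n^'n) measure"
  assumes \<mu>: "sets \<mu> = sets borel" and fin: "norm_moment \<mu> s < \<infinity>" and s: "s > 0"
  shows "norm_moment (mat_conv (nonzero_part \<mu>) n) s = norm_moment (mat_conv \<mu> n) s"
proof -
  let ?P = "PiM {1..n} (\<lambda>_. \<mu>)"
  let ?Z = "\<Pi>\<^sub>E i\<in>{1..n}. - {0 :: real^'n^'n}"
  have [measurable]: "mat_prod n \<in> measurable ?P borel" by (rule measurable_mat_prod[OF \<mu>])
  have [measurable]: "?Z \<in> sets ?P" using \<mu> by (intro sets_PiM_I_finite) auto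
  have "norm_moment (mat_conv (nonzero_part \<mu>) n) s
      = (\<integral>\<^sup>+A. indicator ?Z A * ennreal (opnorm (mat_prod n A) powr s) \<partial>?P)"
    unfolding norm_moment_mat_conv[OF trans[OF sets_nonzero_part \<mu>]]
      PiM_nonzero_part[OF \<mu> fin finite_atLeastAtMost]
    by (rule nn_integral_density) measurable
  also have "\<dots> = (\<integral>\<^sup>+A. ennreal (opnorm (mat_prod n A) powr s) \<partial>?P)"
  proof (rule nn_integral_cong)
    fix A assume A: "A \<in> space ?P"
    show "indicator ?Z A * ennreal (opnorm (mat_prod n A) powr s) = ennreal (opnorm (mat_prod n A) powr s)"
    proof (cases "A \<in> ?Z")
      case False
      then obtain k where "k \<in> {1..n}" "A k = 0"
        using A by (auto simp: space_PiM PiE_iff)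
      then have "mat_prod n A = 0" by (rule mat_prod_eq_0)
      then show ?thesis using s by (simp add: opnorm_zero)
    qed simp
  qed
  finally show ?thesis using \<mu> by (simp add: norm_moment_mat_conv)
qed

section \<open>Moments of random products\<close>

lemma mat_prod_cong: "(\<And>k. k \<in> {1..n} \<Longrightarrow> A k = B k) \<Longrightarrow> mat_prod n A = mat_prod n B"
  by (induction n) auto

lemma mat_prod_fun_upd: "mat_prod (Suc n) (A(Suc n := B)) = mat_prod n A ** B"
proof -
  have "mat_prod n (A(Suc n := B)) = mat_prod n A" by (rule mat_prod_cong) auto
  then show ?thesis by simp
qed

locale matrix_measure = sigma_finite_measure \<mu>
  for \<mu> :: "(real^'n^'n) measure" and s :: real +
  assumes sets_\<mu> [measurable_cong]: "sets \<mu> = sets borel"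
    and s_pos: "s > 0" and moment_finite: "norm_moment \<mu> s < \<infinity>"
begin

sublocale product_sigma_finite "\<lambda>_ :: nat. \<mu>" by standard

abbreviation P :: "nat \<Rightarrow> (nat \<Rightarrow> real^'n^'n) measure" where "P n \<equiv> PiM {1..n} (\<lambda>_. \<mu>)"

abbreviation moment :: "nat \<Rightarrow> ennreal" where "moment n \<equiv> norm_moment (mat_conv \<mu> n) s"

lemma sigma_finite_P: "sigma_finite_measure (P n)"
  by (rule sigma_finite) simp

lemma measurable_mat_prod_P [measurable]: "mat_prod n \<in> borel_measurable (P n)"
  by (rule measurable_mat_prod[OF sets_\<mu>])

lemma moment_eq: "moment n = (\<integral>\<^sup>+A. ennreal (opnorm (mat_prod n A) powr s) \<partial>P n)"
  by (rule norm_moment_mat_conv[OF sets_\<mu>])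

lemma nn_integral_mat_prod_0: "(\<integral>\<^sup>+A. g (mat_prod 0 A) \<partial>P 0) = g (mat 1)"
  by (simp add: space_PiM_empty)

lemma nn_integral_mat_prod_Suc:
  assumes [measurable]: "g \<in> borel_measurable borel"
  shows "(\<integral>\<^sup>+A. g (mat_prod (Suc n) A) \<partial>P (Suc n)) = (\<integral>\<^sup>+B. (\<integral>\<^sup>+A. g (mat_prod n A ** B) \<partial>P n) \<partial>\<mu>)"
proof -
  have I: "{1..Suc n} = insert (Suc n) {1..n}" by auto
  have "(\<lambda>A. g (mat_prod (Suc n) A)) \<in> borel_measurable (P (Suc n))"
    by (rule measurable_compose[OF measurable_mat_prod_P]) fact
  then have "(\<integral>\<^sup>+A. g (mat_prod (Suc n) A) \<partial>P (Suc n))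
      = (\<integral>\<^sup>+B. (\<integral>\<^sup>+A. g (mat_prod (Suc n) (A(Suc n := B))) \<partial>P n) \<partial>\<mu>)"
    unfolding I by (intro product_nn_integral_insert_rev) auto
  then show ?thesis unfolding mat_prod_fun_upd .
qed

text \<open>
  The additional right factor C makes the moments accessible to induction over the last factor of
  the random product.
\<close>
definition right_moment :: "nat \<Rightarrow> real^'n^'n \<Rightarrow> ennreal" where
  "right_moment n C = (\<integral>\<^sup>+A. ennreal (opnorm (mat_prod n A ** C) powr s) \<partial>P n)"

lemma measurable_right_moment [measurable]: "right_moment n \<in> borel_measurable borel"
proof -
  interpret Pn: sigma_finite_measure "P n" by (rule sigma_finite_P)
  have cont: "continuous_on UNIV (\<lambda>p :: (real^'n^'n) \<times> (real^'n^'n). fst p ** snd p)"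
    unfolding matrix_matrix_mult_def by (intro continuous_intros)
  have m1: "(\<lambda>p. mat_prod n (snd p)) \<in> borel_measurable ((borel :: (real^'n^'n) measure) \<Otimes>\<^sub>M P n)"
    by (rule measurable_compose[OF measurable_snd measurable_mat_prod_P])
  have m2: "fst \<in> borel_measurable ((borel :: (real^'n^'n) measure) \<Otimes>\<^sub>M P n)"
    by (rule measurable_fst)
  have m: "(\<lambda>p. mat_prod n (snd p) ** fst p)
      \<in> borel_measurable ((borel :: (real^'n^'n) measure) \<Otimes>\<^sub>M P n)"
    using borel_measurable_continuous_Pair[OF m1 m2 cont] by (simp only: fst_conv snd_conv)
  have "(\<lambda>X :: real^'n^'n. ennreal (opnorm X powr s)) \<in> borel_measurable borel" by measurable
  from measurable_compose[OF m this]
  have "(\<lambda>(C, A). ennreal (opnorm (mat_prod n A ** C) powr s))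
      \<in> borel_measurable ((borel :: (real^'n^'n) measure) \<Otimes>\<^sub>M P n)"
    by (simp only: case_prod_beta')
  then show ?thesis
    unfolding right_moment_def by (rule Pn.borel_measurable_nn_integral)
qed

lemma right_moment_Suc: "right_moment (Suc n) C = (\<integral>\<^sup>+B. right_moment n (B ** C) \<partial>\<mu>)"
  unfolding right_moment_def
  by (subst nn_integral_mat_prod_Suc[of "\<lambda>X. ennreal (opnorm (X ** C) powr s)"])
    (simp_all add: matrix_mul_assoc)

lemma moment_eq_right_moment: "moment n = right_moment n (mat 1)"
  unfolding moment_eq right_moment_def by simp

lemma right_moment_le: "right_moment n C \<le> moment n * ennreal (opnorm C powr s)"
proof -
  have "right_moment n C \<le> (\<integral>\<^sup>+A. ennreal (opnorm (mat_prod n A) powr s) * ennreal (opnorm C powr s) \<partial>P n)"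
    unfolding right_moment_def
  proof (rule nn_integral_mono)
    fix A
    have "opnorm (mat_prod n A ** C) powr s \<le> (opnorm (mat_prod n A) * opnorm C) powr s"
      using s_pos by (intro powr_mono2 opnorm_mult_le) (auto simp: opnorm_nonneg)
    then show "ennreal (opnorm (mat_prod n A ** C) powr s)
        \<le> ennreal (opnorm (mat_prod n A) powr s) * ennreal (opnorm C powr s)"
      by (simp add: powr_mult opnorm_nonneg ennreal_mult[symmetric])
  qed
  also have "\<dots> = moment n * ennreal (opnorm C powr s)"
    unfolding moment_eq by (rule nn_integral_multc) measurable
  finally show ?thesis .
qed

text \<open>
  The rightmost m factors are split off one at a time into the argument C.
\<close>
lemma right_moment_add_le: "right_moment (n + m) C \<le> moment n * right_moment m C"
proof (induction m arbitrary: C)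
  case 0
  have "right_moment 0 C = ennreal (opnorm C powr s)"
    unfolding right_moment_def using nn_integral_mat_prod_0[of "\<lambda>X. ennreal (opnorm (X ** C) powr s)"] by simp
  then show ?case using right_moment_le[of n C] by simp
next
  case (Suc m)
  have "right_moment (n + Suc m) C = (\<integral>\<^sup>+B. right_moment (n + m) (B ** C) \<partial>\<mu>)"
    by (simp add: right_moment_Suc)
  also have "\<dots> \<le> (\<integral>\<^sup>+B. moment n * right_moment m (B ** C) \<partial>\<mu>)"
    by (intro nn_integral_mono Suc.IH)
  also have "\<dots> = moment n * (\<integral>\<^sup>+B. right_moment m (B ** C) \<partial>\<mu>)"
    by (rule nn_integral_cmult) measurable
  finally show ?case by (simp add: right_moment_Suc)
qed

lemma moment_add_le: "moment (n + m) \<le> moment n * moment m"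
  unfolding moment_eq_right_moment[of "n + m"] moment_eq_right_moment[of m] by (rule right_moment_add_le)

lemma moment_0: "moment 0 = 1"
  unfolding moment_eq using nn_integral_mat_prod_0[of "\<lambda>X. ennreal (opnorm X powr s)"]
  by (simp add: opnorm_mat_1)

lemma moment_1: "moment 1 = norm_moment \<mu> s"
proof -
  have "right_moment 0 B = ennreal (opnorm B powr s)" for B
    unfolding right_moment_def using nn_integral_mat_prod_0[of "\<lambda>X. ennreal (opnorm (X ** B) powr s)"] by simp
  then have "right_moment (Suc 0) (mat 1) = norm_moment \<mu> s"
    unfolding right_moment_Suc norm_moment_def by simp
  then show ?thesis unfolding moment_eq_right_moment by simp
qed

lemma moment_less_top: "moment n < \<infinity>"
proof (induction n)
  case 0
  show ?case by (simp add: moment_0)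
next
  case (Suc n)
  have "moment (Suc n) \<le> moment n * moment 1" using moment_add_le[of n 1] by simp
  also have "\<dots> < \<infinity>" using Suc moment_finite unfolding moment_1 by (simp add: ennreal_mult_less_top)
  finally show ?case .
qed

lemma pressure_LIMSEQ: "(\<lambda>n. ereal (1 / real n) * elog (moment n)) \<longlonglongrightarrow> norm_pressure \<mu> s"
  unfolding norm_pressure_def
  using fekete_root_elog[of moment, OF moment_less_top moment_add_le]
  by (simp add: convergent_LIMSEQ_iff)

lemma eexp_pressure_less_top: "eexp (norm_pressure \<mu> s) < \<infinity>"
proof -
  \<comment> \<open>The maximum with 1 covers a vanishing first moment.\<close>
  define c where "c = ln (max 1 (enn2real (moment 1)))"
  have "moment 1 = ennreal (enn2real (moment 1))" using moment_less_top[of 1] by simp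
  also have "\<dots> \<le> ennreal (exp (c * real 1))"
    unfolding c_def by (intro ennreal_leI) simp
  finally have "ereal (1 / real 1) * elog (moment 1) \<le> ereal c"
    by (subst root_elog_le_iff) auto
  then have "limsup (\<lambda>n. ereal (1 / real n) * elog (moment n)) \<le> ereal c"
    by (intro limsup_root_elog_le[OF moment_less_top moment_add_le]) auto
  then have "norm_pressure \<mu> s \<le> ereal c"
    using lim_imp_Limsup[OF _ pressure_LIMSEQ] by simp
  then show ?thesis by (auto simp: eexp_def)
qed

section \<open>Vector moments\<close>

definition vec_moment :: "nat \<Rightarrow> real^'n \<Rightarrow> ennreal" where
  "vec_moment n v = (\<integral>\<^sup>+A. ennreal (norm (mat_prod n A *v v) powr s) \<partial>P n)"

lemma vec_moment_0: "vec_moment 0 v = ennreal (norm v powr s)"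
  unfolding vec_moment_def using nn_integral_mat_prod_0[of "\<lambda>X. ennreal (norm (X *v v) powr s)"] by simp

lemma vec_moment_Suc: "vec_moment (Suc n) v = (\<integral>\<^sup>+B. vec_moment n (B *v v) \<partial>\<mu>)"
  unfolding vec_moment_def
  by (subst nn_integral_mat_prod_Suc[of "\<lambda>X. ennreal (norm (X *v v) powr s)"])
    (simp_all add: matrix_vector_mul_assoc)

lemma norm_powr_le: "norm (A *v v) powr s \<le> opnorm A powr s * norm v powr s"
proof -
  have "norm (A *v v) powr s \<le> (opnorm A * norm v) powr s"
    using s_pos by (intro powr_mono2 norm_mult_le_opnorm) auto
  then show ?thesis by (simp add: powr_mult opnorm_nonneg)
qed

lemma vec_moment_le: "vec_moment n v \<le> moment n * ennreal (norm v powr s)"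
proof -
  have "vec_moment n v \<le> (\<integral>\<^sup>+A. ennreal (opnorm (mat_prod n A) powr s) * ennreal (norm v powr s) \<partial>P n)"
    unfolding vec_moment_def
    by (intro nn_integral_mono) (simp add: ennreal_mult[symmetric] norm_powr_le)
  also have "\<dots> = moment n * ennreal (norm v powr s)"
    unfolding moment_eq by (rule nn_integral_multc) measurable
  finally show ?thesis .
qed

lemma vec_moment_less_top: "vec_moment n v < \<infinity>"
proof -
  have "moment n * ennreal (norm v powr s) < \<infinity>"
    using moment_less_top[of n] by (simp add: ennreal_mult_less_top)
  with vec_moment_le[of n v] show ?thesis by (rule le_less_trans)
qed

lemma vec_moment_scaleR: "vec_moment n (c *\<^sub>R v) = ennreal (\<bar>c\<bar> powr s) * vec_moment n v"
proof -
  have "vec_moment n (c *\<^sub>R v) = (\<integral>\<^sup>+A. ennreal (\<bar>c\<bar> powr s) * ennreal (norm (mat_prod n A *v v) powr s) \<partial>P n)"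
    unfolding vec_moment_def
  proof (rule nn_integral_cong)
    fix A
    have "norm (mat_prod n A *v (c *\<^sub>R v)) powr s = \<bar>c\<bar> powr s * norm (mat_prod n A *v v) powr s"
      by (simp add: matrix_vector_mult_scaleR powr_mult)
    then show "ennreal (norm (mat_prod n A *v (c *\<^sub>R v)) powr s)
        = ennreal (\<bar>c\<bar> powr s) * ennreal (norm (mat_prod n A *v v) powr s)"
      by (simp only: ennreal_mult[OF powr_ge_zero powr_ge_zero])
  qed
  also have "\<dots> = ennreal (\<bar>c\<bar> powr s) * vec_moment n v"
    unfolding vec_moment_def by (rule nn_integral_cmult) measurable
  finally show ?thesis .
qed

lemma vec_moment_sum_le:
  fixes c :: "'i \<Rightarrow> real"
  assumes "finite I"
  shows "vec_moment n (\<Sum>k\<in>I. c k *\<^sub>R w k)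
    \<le> ennreal ((\<Sum>k\<in>I. \<bar>c k\<bar> powr min s 1) powr (max s 1 - 1)) *
      (\<Sum>k\<in>I. ennreal (\<bar>c k\<bar> powr min s 1) * vec_moment n (w k))"
proof -
  define Q where "Q = (\<Sum>k\<in>I. \<bar>c k\<bar> powr min s 1) powr (max s 1 - 1)"
  have Q: "Q \<ge> 0" unfolding Q_def by simp
  have "vec_moment n (\<Sum>k\<in>I. c k *\<^sub>R w k)
      \<le> (\<integral>\<^sup>+A. ennreal Q * (\<Sum>k\<in>I. ennreal (\<bar>c k\<bar> powr min s 1) * ennreal (norm (mat_prod n A *v w k) powr s)) \<partial>P n)"
    unfolding vec_moment_def
  proof (rule nn_integral_mono)
    fix A
    have "mat_prod n A *v (\<Sum>k\<in>I. c k *\<^sub>R w k) = (\<Sum>k\<in>I. c k *\<^sub>R (mat_prod n A *v w k))"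
      by (simp only: linear_sum[OF matrix_vector_mul_linear] matrix_vector_mult_scaleR)
    then have "norm (mat_prod n A *v (\<Sum>k\<in>I. c k *\<^sub>R w k)) powr s
        \<le> Q * (\<Sum>k\<in>I. \<bar>c k\<bar> powr min s 1 * norm (mat_prod n A *v w k) powr s)"
      unfolding Q_def using norm_sum_powr_le[OF assms s_pos] by simp
    then have "ennreal (norm (mat_prod n A *v (\<Sum>k\<in>I. c k *\<^sub>R w k)) powr s)
        \<le> ennreal (Q * (\<Sum>k\<in>I. \<bar>c k\<bar> powr min s 1 * norm (mat_prod n A *v w k) powr s))"
      by (rule ennreal_leI)
    also have "\<dots> = ennreal Q * ennreal (\<Sum>k\<in>I. \<bar>c k\<bar> powr min s 1 * norm (mat_prod n A *v w k) powr s)"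
      by (intro ennreal_mult Q sum_nonneg) simp
    also have "ennreal (\<Sum>k\<in>I. \<bar>c k\<bar> powr min s 1 * norm (mat_prod n A *v w k) powr s)
        = (\<Sum>k\<in>I. ennreal (\<bar>c k\<bar> powr min s 1 * norm (mat_prod n A *v w k) powr s))"
      by (rule sum_ennreal[symmetric]) simp
    also have "\<dots> = (\<Sum>k\<in>I. ennreal (\<bar>c k\<bar> powr min s 1) * ennreal (norm (mat_prod n A *v w k) powr s))"
      by (simp only: ennreal_mult[OF powr_ge_zero powr_ge_zero])
    finally show "ennreal (norm (mat_prod n A *v (\<Sum>k\<in>I. c k *\<^sub>R w k)) powr s)
        \<le> ennreal Q * (\<Sum>k\<in>I. ennreal (\<bar>c k\<bar> powr min s 1) * ennreal (norm (mat_prod n A *v w k) powr s))" .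
  qed
  also have "\<dots> = ennreal Q * (\<Sum>k\<in>I. ennreal (\<bar>c k\<bar> powr min s 1) * vec_moment n (w k))"
    unfolding vec_moment_def
  proof -
    define g where "g k A = ennreal (norm (mat_prod n A *v w k) powr s)" for k A
    have g [measurable]: "g k \<in> borel_measurable (P n)" for k unfolding g_def by measurable
    have "(\<integral>\<^sup>+A. ennreal Q * (\<Sum>k\<in>I. ennreal (\<bar>c k\<bar> powr min s 1) * g k A) \<partial>P n)
        = ennreal Q * (\<integral>\<^sup>+A. (\<Sum>k\<in>I. ennreal (\<bar>c k\<bar> powr min s 1) * g k A) \<partial>P n)"
      by (rule nn_integral_cmult) measurable
    also have "(\<integral>\<^sup>+A. (\<Sum>k\<in>I. ennreal (\<bar>c k\<bar> powr min s 1) * g k A) \<partial>P n)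
        = (\<Sum>k\<in>I. \<integral>\<^sup>+A. ennreal (\<bar>c k\<bar> powr min s 1) * g k A \<partial>P n)"
      by (rule nn_integral_sum) measurable
    also have "\<dots> = (\<Sum>k\<in>I. ennreal (\<bar>c k\<bar> powr min s 1) * (\<integral>\<^sup>+A. g k A \<partial>P n))"
      by (intro sum.cong refl nn_integral_cmult g)
    finally show "(\<integral>\<^sup>+A. ennreal Q * (\<Sum>k\<in>I. ennreal (\<bar>c k\<bar> powr min s 1) * ennreal (norm (mat_prod n A *v w k) powr s)) \<partial>P n)
        = ennreal Q * (\<Sum>k\<in>I. ennreal (\<bar>c k\<bar> powr min s 1) * (\<integral>\<^sup>+A. ennreal (norm (mat_prod n A *v w k) powr s) \<partial>P n))"
      unfolding g_def .
  qed
  finally show ?thesis unfolding Q_def .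
qed

lemma vec_moment_tendsto:
  assumes "v \<longlonglongrightarrow> l"
  shows "(\<lambda>i. vec_moment n (v i)) \<longlonglongrightarrow> vec_moment n l"
proof -
  have "Bseq v" by (rule convergent_imp_Bseq[OF convergentI[OF assms]])
  then obtain R where R: "\<And>i. norm (v i) \<le> R" unfolding Bseq_def by blast
  show ?thesis unfolding vec_moment_def
  proof (rule nn_integral_dominated_convergence)
    show "AE A in P n. ennreal (norm (mat_prod n A *v v i) powr s)
        \<le> ennreal (opnorm (mat_prod n A) powr s) * ennreal (R powr s)" for i
    proof (rule AE_I2)
      fix A
      have "norm (mat_prod n A *v v i) powr s \<le> opnorm (mat_prod n A) powr s * norm (v i) powr s"
        by (rule norm_powr_le)
      also have "\<dots> \<le> opnorm (mat_prod n A) powr s * R powr s"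
        using R[of i] s_pos by (intro mult_left_mono powr_mono2) auto
      finally show "ennreal (norm (mat_prod n A *v v i) powr s)
        \<le> ennreal (opnorm (mat_prod n A) powr s) * ennreal (R powr s)"
        by (simp add: ennreal_mult[symmetric] ennreal_leI)
    qed
    have "(\<integral>\<^sup>+A. ennreal (opnorm (mat_prod n A) powr s) * ennreal (R powr s) \<partial>P n)
        = moment n * ennreal (R powr s)"
      unfolding moment_eq by (rule nn_integral_multc) measurable
    also have "\<dots> < \<infinity>" using moment_less_top[of n] by (simp add: ennreal_mult_less_top)
    finally show "(\<integral>\<^sup>+A. ennreal (opnorm (mat_prod n A) powr s) * ennreal (R powr s) \<partial>P n) < \<infinity>" .
    show "AE A in P n. (\<lambda>i. ennreal (norm (mat_prod n A *v v i) powr s))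
        \<longlonglongrightarrow> ennreal (norm (mat_prod n A *v l) powr s)"
    proof (rule AE_I2)
      fix A
      have "(\<lambda>i. mat_prod n A *v v i) \<longlonglongrightarrow> mat_prod n A *v l"
        by (rule bounded_linear.tendsto[OF matrix_vector_mul_bounded_linear assms])
      then have "(\<lambda>i. norm (mat_prod n A *v v i) powr s) \<longlonglongrightarrow> norm (mat_prod n A *v l) powr s"
        using s_pos by (intro tendsto_powr2 tendsto_norm tendsto_const) auto
      then show "(\<lambda>i. ennreal (norm (mat_prod n A *v v i) powr s))
        \<longlonglongrightarrow> ennreal (norm (mat_prod n A *v l) powr s)" by (rule tendsto_ennrealI)
    qed
  qed measurable
qed

definition real_vec_moment :: "nat \<Rightarrow> real^'n \<Rightarrow> real" where
  "real_vec_moment n v = enn2real (vec_moment n v)"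

lemma real_vec_moment_nonneg: "real_vec_moment n v \<ge> 0"
  unfolding real_vec_moment_def by simp

lemma ennreal_real_vec_moment: "ennreal (real_vec_moment n v) = vec_moment n v"
  unfolding real_vec_moment_def using vec_moment_less_top[of n v] by simp

lemma real_vec_moment_0: "real_vec_moment 0 v = norm v powr s"
  unfolding real_vec_moment_def vec_moment_0 by simp

lemma real_vec_moment_scaleR: "real_vec_moment n (c *\<^sub>R v) = \<bar>c\<bar> powr s * real_vec_moment n v"
  unfolding real_vec_moment_def vec_moment_scaleR by (simp add: enn2real_mult)

lemma real_vec_moment_sum_le:
  fixes c :: "'i \<Rightarrow> real"
  assumes "finite I"
  shows "real_vec_moment n (\<Sum>k\<in>I. c k *\<^sub>R w k)
    \<le> (\<Sum>k\<in>I. \<bar>c k\<bar> powr min s 1) powr (max s 1 - 1) * (\<Sum>k\<in>I. \<bar>c k\<bar> powr min s 1 * real_vec_moment n (w k))"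
proof -
  define Q where "Q = (\<Sum>k\<in>I. \<bar>c k\<bar> powr min s 1) powr (max s 1 - 1)"
  have Q: "Q \<ge> 0" unfolding Q_def by simp
  have nonneg: "0 \<le> (\<Sum>k\<in>I. \<bar>c k\<bar> powr min s 1 * real_vec_moment n (w k))"
    by (intro sum_nonneg mult_nonneg_nonneg real_vec_moment_nonneg) simp
  have "ennreal (real_vec_moment n (\<Sum>k\<in>I. c k *\<^sub>R w k))
      \<le> ennreal Q * (\<Sum>k\<in>I. ennreal (\<bar>c k\<bar> powr min s 1) * ennreal (real_vec_moment n (w k)))"
    unfolding ennreal_real_vec_moment Q_def by (rule vec_moment_sum_le[OF assms])
  also have "(\<Sum>k\<in>I. ennreal (\<bar>c k\<bar> powr min s 1) * ennreal (real_vec_moment n (w k)))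
      = (\<Sum>k\<in>I. ennreal (\<bar>c k\<bar> powr min s 1 * real_vec_moment n (w k)))"
    by (intro sum.cong refl ennreal_mult[symmetric] real_vec_moment_nonneg powr_ge_zero)
  also have "\<dots> = ennreal (\<Sum>k\<in>I. \<bar>c k\<bar> powr min s 1 * real_vec_moment n (w k))"
    by (intro sum_ennreal mult_nonneg_nonneg real_vec_moment_nonneg powr_ge_zero)
  also have "ennreal Q * \<dots> = ennreal (Q * (\<Sum>k\<in>I. \<bar>c k\<bar> powr min s 1 * real_vec_moment n (w k)))"
    by (rule ennreal_mult[OF Q nonneg, symmetric])
  finally have "real_vec_moment n (\<Sum>k\<in>I. c k *\<^sub>R w k) \<le> Q * (\<Sum>k\<in>I. \<bar>c k\<bar> powr min s 1 * real_vec_moment n (w k))"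
    using mult_nonneg_nonneg[OF Q nonneg] by (subst (asm) ennreal_le_iff)
  then show ?thesis unfolding Q_def .
qed

lemma continuous_on_real_vec_moment: "continuous_on UNIV (real_vec_moment n)"
proof -
  have "isCont (real_vec_moment n) v" for v
    unfolding continuous_at_sequentially
  proof (intro allI impI)
    fix x assume "x \<longlonglongrightarrow> v"
    then have "(\<lambda>i. vec_moment n (x i)) \<longlonglongrightarrow> vec_moment n v" by (rule vec_moment_tendsto)
    then have "(\<lambda>i. enn2real (vec_moment n (x i))) \<longlonglongrightarrow> enn2real (vec_moment n v)"
      using vec_moment_less_top[of n v] real_vec_moment_nonneg[of n v]
      by (intro tendsto_enn2real) (auto simp: ennreal_real_vec_moment[symmetric] real_vec_moment_def[symmetric])
    then show "(real_vec_moment n \<circ> x) \<longlonglongrightarrow> real_vec_moment n v" unfolding real_vec_moment_def comp_def .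
  qed
  then show ?thesis by (simp add: continuous_at_imp_continuous_on)
qed

lemma measurable_real_vec_moment [measurable]: "real_vec_moment n \<in> borel_measurable borel"
  by (rule borel_measurable_continuous_onI[OF continuous_on_real_vec_moment])

lemma nn_integral_real_vec_moment: "(\<integral>\<^sup>+A. ennreal (real_vec_moment n (A *v v)) \<partial>\<mu>) = ennreal (real_vec_moment (Suc n) v)"
  unfolding ennreal_real_vec_moment vec_moment_Suc ..

lemma real_vec_moment_le:
  assumes "moment n \<le> ennreal b" "b \<ge> 0"
  shows "real_vec_moment n v \<le> b * norm v powr s"
proof -
  have "ennreal (real_vec_moment n v) \<le> moment n * ennreal (norm v powr s)"
    unfolding ennreal_real_vec_moment by (rule vec_moment_le)
  also have "\<dots> \<le> ennreal b * ennreal (norm v powr s)"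
    by (intro mult_right_mono assms(1)) simp
  also have "\<dots> = ennreal (b * norm v powr s)"
    using assms(2) by (intro ennreal_mult[symmetric]) auto
  finally show ?thesis
    using assms(2) by (subst (asm) ennreal_le_iff) auto
qed

text \<open>
  F(v) is the sum over n < m of the vector moments divided by a^n. Integrating F(A v) raises every
  index n by one, which costs the factor a; the term for n = m created in this way is at most
  |v|^s, the term for n = 0, by the choice of m.
\<close>
lemma contracted_function_exists:
  assumes a: "a > 0" and m: "m \<ge> 1" "moment m \<le> ennreal (a ^ m)"
  obtains F :: "real^'n \<Rightarrow> real"
  where "continuous_on UNIV F" "\<And>v. norm v powr s \<le> F v"
    "\<And>c v. F (c *\<^sub>R v) = \<bar>c\<bar> powr s * F v"
    "\<And>(c :: 'n \<Rightarrow> real) w. F (\<Sum>k\<in>UNIV. c k *\<^sub>R w k)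
      \<le> (\<Sum>k\<in>UNIV. \<bar>c k\<bar> powr min s 1) powr (max s 1 - 1) * (\<Sum>k\<in>UNIV. \<bar>c k\<bar> powr min s 1 * F (w k))"
    "\<And>v. (\<integral>\<^sup>+A. ennreal (F (A *v v)) \<partial>\<mu>) \<le> ennreal (a * F v)"
proof -
  define F where "F v = (\<Sum>n<m. real_vec_moment n v / a ^ n)" for v
  have term_nonneg: "0 \<le> real_vec_moment n v / a ^ n" for n v using a real_vec_moment_nonneg by simp
  show ?thesis
  proof (rule that[of F])
    show "continuous_on UNIV F"
      unfolding F_def using a by (intro continuous_intros continuous_on_real_vec_moment) auto
    fix v
    have "real_vec_moment 0 v / a ^ 0 \<le> F v"
      unfolding F_def using m(1) term_nonneg by (intro member_le_sum) auto
    then show "norm v powr s \<le> F v" by (simp add: real_vec_moment_0)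
    show "F (c *\<^sub>R v) = \<bar>c\<bar> powr s * F v" for c
      unfolding F_def by (simp add: real_vec_moment_scaleR sum_distrib_left)
    have "(\<integral>\<^sup>+A. ennreal (F (A *v v)) \<partial>\<mu>)
        = (\<integral>\<^sup>+A. (\<Sum>n<m. ennreal (1 / a ^ n) * ennreal (real_vec_moment n (A *v v))) \<partial>\<mu>)"
    proof (rule nn_integral_cong)
      fix A
      have "ennreal (F (A *v v)) = (\<Sum>n<m. ennreal (real_vec_moment n (A *v v) / a ^ n))"
        unfolding F_def by (rule sum_ennreal[symmetric]) (rule term_nonneg)
      also have "\<dots> = (\<Sum>n<m. ennreal (1 / a ^ n) * ennreal (real_vec_moment n (A *v v)))"
        using a by (intro sum.cong refl) (simp add: ennreal_mult[symmetric] real_vec_moment_nonneg)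
      finally show "ennreal (F (A *v v)) = \<dots>" .
    qed
    also have "\<dots> = (\<Sum>n<m. \<integral>\<^sup>+A. ennreal (1 / a ^ n) * ennreal (real_vec_moment n (A *v v)) \<partial>\<mu>)"
      by (rule nn_integral_sum) measurable
    also have "\<dots> = (\<Sum>n<m. ennreal (1 / a ^ n) * (\<integral>\<^sup>+A. ennreal (real_vec_moment n (A *v v)) \<partial>\<mu>))"
      by (intro sum.cong refl nn_integral_cmult) measurable
    also have "\<dots> = (\<Sum>n<m. ennreal (a * (real_vec_moment (Suc n) v / a ^ Suc n)))"
      using a unfolding nn_integral_real_vec_moment
      by (intro sum.cong refl) (simp add: ennreal_mult[symmetric] real_vec_moment_nonneg)
    also have "\<dots> = ennreal (\<Sum>n<m. a * (real_vec_moment (Suc n) v / a ^ Suc n))"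
      using a by (intro sum_ennreal mult_nonneg_nonneg term_nonneg) auto
    also have "\<dots> \<le> ennreal (a * F v)"
    proof (rule ennreal_leI)
      have "real_vec_moment m v \<le> a ^ m * norm v powr s"
        using a by (intro real_vec_moment_le m(2)) simp
      then have "real_vec_moment m v / a ^ m \<le> real_vec_moment 0 v / a ^ 0"
        using a by (simp add: real_vec_moment_0 divide_le_eq mult.commute)
      moreover have "real_vec_moment 0 v / a ^ 0 + (\<Sum>n<m. real_vec_moment (Suc n) v / a ^ Suc n) = (\<Sum>n<Suc m. real_vec_moment n v / a ^ n)"
        by (rule sum.lessThan_Suc_shift[symmetric])
      moreover have "(\<Sum>n<Suc m. real_vec_moment n v / a ^ n) = F v + real_vec_moment m v / a ^ m"
        unfolding F_def by (rule sum.lessThan_Suc)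
      ultimately have "(\<Sum>n<m. real_vec_moment (Suc n) v / a ^ Suc n) \<le> F v" by linarith
      then have "a * (\<Sum>n<m. real_vec_moment (Suc n) v / a ^ Suc n) \<le> a * F v"
        using a by (intro mult_left_mono) auto
      then show "(\<Sum>n<m. a * (real_vec_moment (Suc n) v / a ^ Suc n)) \<le> a * F v"
        unfolding sum_distrib_left .
    qed
    finally show "(\<integral>\<^sup>+A. ennreal (F (A *v v)) \<partial>\<mu>) \<le> ennreal (a * F v)" .
  next
    fix c :: "'n \<Rightarrow> real" and w
    define Q where "Q = (\<Sum>k\<in>UNIV. \<bar>c k\<bar> powr min s 1) powr (max s 1 - 1)"
    have "F (\<Sum>k\<in>UNIV. c k *\<^sub>R w k)
        \<le> (\<Sum>n<m. Q * (\<Sum>k\<in>UNIV. \<bar>c k\<bar> powr min s 1 * real_vec_moment n (w k)) / a ^ n)"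
      unfolding F_def Q_def using a by (intro sum_mono divide_right_mono real_vec_moment_sum_le) auto
    also have "\<dots> = (\<Sum>n<m. \<Sum>k\<in>UNIV. Q * (\<bar>c k\<bar> powr min s 1 * (real_vec_moment n (w k) / a ^ n)))"
      by (simp add: sum_distrib_left sum_divide_distrib)
    also have "\<dots> = (\<Sum>k\<in>UNIV. \<Sum>n<m. Q * (\<bar>c k\<bar> powr min s 1 * (real_vec_moment n (w k) / a ^ n)))"
      by (rule sum.swap)
    also have "\<dots> = Q * (\<Sum>k\<in>UNIV. \<bar>c k\<bar> powr min s 1 * F (w k))"
      unfolding F_def by (simp only: sum_distrib_left)
    finally show "F (\<Sum>k\<in>UNIV. c k *\<^sub>R w k)
        \<le> (\<Sum>k\<in>UNIV. \<bar>c k\<bar> powr min s 1) powr (max s 1 - 1) * (\<Sum>k\<in>UNIV. \<bar>c k\<bar> powr min s 1 * F (w k))"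
      unfolding Q_def .
  qed
qed

section \<open>The moment inequality\<close>

text \<open>
  The weights w turn the comparison with F into a bound on the entries with \<delta> j \<le> \<delta> i by the function
  q, whose integral is at most a d^(1 + max s 1): each of the d basis vectors contributes the
  distortion d^(max s 1). The path argument contributes d^(d s), and the choice of the exceptional
  factor another d. The product of these constants is the constant of the theorem times a.
\<close>
lemma moment_dim_le:
  assumes a: "eexp (norm_pressure \<mu> s) < ennreal a"
  shows "moment CARD('n) \<le> ennreal (K_const (real CARD('n)) s * a) * norm_moment \<mu> s ^ (CARD('n) - 1)"
proof -
  let ?n = "CARD('n)"
  define d where "d = real ?n"
  define r where "r = max s 1"
  have d1: "d \<ge> 1" unfolding d_def by (simp add: Suc_le_eq)
  have a0: "a > 0" using a by (metis ennreal_neg not_less not_less_zero)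
  obtain m where m: "m \<ge> 1" "moment m \<le> ennreal (a ^ m)"
    using exists_le_power_if_eexp_less[OF pressure_LIMSEQ a] by blast
  obtain F :: "real^'n \<Rightarrow> real" where cont: "continuous_on UNIV F" and lower: "\<And>v. norm v powr s \<le> F v"
    and hom: "\<And>c v. F (c *\<^sub>R v) = \<bar>c\<bar> powr s * F v"
    and sum_le: "\<And>(c :: 'n \<Rightarrow> real) w. F (\<Sum>k\<in>UNIV. c k *\<^sub>R w k)
      \<le> (\<Sum>k\<in>UNIV. \<bar>c k\<bar> powr min s 1) powr (max s 1 - 1) * (\<Sum>k\<in>UNIV. \<bar>c k\<bar> powr min s 1 * F (w k))"
    and contr: "\<And>v. (\<integral>\<^sup>+A. ennreal (F (A *v v)) \<partial>\<mu>) \<le> ennreal (a * F v)"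
    using contracted_function_exists[OF a0 m] by blast
  have F0: "F v \<ge> 0" for v using lower[of v] by (rule order_trans[rotated]) simp
  have [measurable]: "F \<in> borel_measurable borel" using cont by (rule borel_measurable_continuous_onI)
  have closed: "closed {v. F v \<le> 1}" by (intro closed_Collect_le cont continuous_on_const)
  obtain u :: "'n \<Rightarrow> real^'n" and \<delta> :: "'n \<Rightarrow> real" where unit: "\<And>i. norm (u i) = 1"
    and expand: "\<And>y. (\<Sum>i\<in>UNIV. (u i \<bullet> y) *\<^sub>R u i) = y" and \<delta>: "\<And>i. \<delta> i > 0"
    and coord: "\<And>i y. (\<delta> i * \<bar>u i \<bullet> y\<bar>) powr s \<le> d powr (s / 2) * F y"
    and Fu: "\<And>i. F (u i) \<le> d powr (r - s / 2) * \<delta> i powr s"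
    using adapted_orthonormal_basis[OF closed lower hom s_pos sum_le] unfolding d_def r_def by blast
  define w where "w j = d powr (s / 2) / \<delta> j powr s" for j
  have w0: "w j \<ge> 0" for j unfolding w_def by simp
  define q where "q A = (\<Sum>j\<in>UNIV. w j * F (A *v u j))" for A
  have term0: "0 \<le> w j * F (A *v u j)" for j A using w0 F0 by simp
  have q0: "q A \<ge> 0" for A unfolding q_def by (intro sum_nonneg term0)
  have [measurable]: "q \<in> borel_measurable borel" unfolding q_def by measurable
  have entry: "\<bar>u i \<bullet> (A *v u j)\<bar> \<le> q A powr (1 / s)" if "\<delta> j \<le> \<delta> i" for A i j
  proof -
    have "\<delta> j powr s * \<bar>u i \<bullet> (A *v u j)\<bar> powr s = (\<delta> j * \<bar>u i \<bullet> (A *v u j)\<bar>) powr s"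
      using \<delta>[of j] by (simp add: powr_mult)
    also have "\<dots> \<le> (\<delta> i * \<bar>u i \<bullet> (A *v u j)\<bar>) powr s"
      using that \<delta>[of j] s_pos by (intro powr_mono2 mult_right_mono) auto
    also have "\<dots> \<le> d powr (s / 2) * F (A *v u j)" by (rule coord)
    finally have "\<bar>u i \<bullet> (A *v u j)\<bar> powr s \<le> w j * F (A *v u j)"
      using \<delta>[of j] unfolding w_def by (simp add: le_divide_eq mult.commute)
    also have "\<dots> \<le> q A"
      unfolding q_def using term0 by (intro member_le_sum) auto
    finally have "(\<bar>u i \<bullet> (A *v u j)\<bar> powr s) powr (1 / s) \<le> q A powr (1 / s)"
      using s_pos by (intro powr_mono2) auto
    then show ?thesis using s_pos by (simp add: powr_powr)
  qed
  have int_q: "(\<integral>\<^sup>+A. ennreal (q A) \<partial>\<mu>) \<le> ennreal (a * d powr (1 + r))"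
  proof -
    have "(\<integral>\<^sup>+A. ennreal (q A) \<partial>\<mu>) = (\<integral>\<^sup>+A. (\<Sum>j\<in>UNIV. ennreal (w j) * ennreal (F (A *v u j))) \<partial>\<mu>)"
    proof (rule nn_integral_cong)
      fix A
      have "ennreal (q A) = (\<Sum>j\<in>UNIV. ennreal (w j * F (A *v u j)))"
        unfolding q_def by (rule sum_ennreal[symmetric]) (rule term0)
      also have "\<dots> = (\<Sum>j\<in>UNIV. ennreal (w j) * ennreal (F (A *v u j)))"
        by (intro sum.cong refl ennreal_mult w0 F0)
      finally show "ennreal (q A) = (\<Sum>j\<in>UNIV. ennreal (w j) * ennreal (F (A *v u j)))" .
    qed
    also have "\<dots> = (\<Sum>j\<in>UNIV. \<integral>\<^sup>+A. ennreal (w j) * ennreal (F (A *v u j)) \<partial>\<mu>)"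
      by (rule nn_integral_sum) measurable
    also have "\<dots> = (\<Sum>j\<in>UNIV. ennreal (w j) * (\<integral>\<^sup>+A. ennreal (F (A *v u j)) \<partial>\<mu>))"
      by (intro sum.cong refl nn_integral_cmult) measurable
    also have "\<dots> \<le> (\<Sum>j\<in>(UNIV::'n set). ennreal (a * d powr r))"
    proof (rule sum_mono)
      fix j :: 'n
      have "ennreal (w j) * (\<integral>\<^sup>+A. ennreal (F (A *v u j)) \<partial>\<mu>) \<le> ennreal (w j) * ennreal (a * F (u j))"
        by (intro mult_left_mono contr) simp
      also have "\<dots> = ennreal (w j * (a * F (u j)))"
        using a0 F0 by (intro ennreal_mult[symmetric] w0) simp
      also have "\<dots> \<le> ennreal (a * d powr r)"
      proof (rule ennreal_leI)
        have "w j * (a * F (u j)) \<le> w j * (a * (d powr (r - s / 2) * \<delta> j powr s))"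
          using a0 by (intro mult_left_mono Fu w0) auto
        also have "\<dots> = a * (d powr (s / 2) * d powr (r - s / 2))"
          using \<delta>[of j] unfolding w_def by simp
        also have "\<dots> = a * d powr r" by (simp add: powr_add[symmetric])
        finally show "w j * (a * F (u j)) \<le> a * d powr r" .
      qed
      finally show "ennreal (w j) * (\<integral>\<^sup>+A. ennreal (F (A *v u j)) \<partial>\<mu>) \<le> ennreal (a * d powr r)" .
    qed
    also have "\<dots> = ennreal (\<Sum>j\<in>(UNIV::'n set). a * d powr r)"
      using a0 by (intro sum_ennreal) simp
    also have "(\<Sum>j\<in>(UNIV::'n set). a * d powr r) = a * d powr (1 + r)"
      using d1 by (simp add: powr_add d_def)
    finally show ?thesis .
  qed
  \<comment> \<open>The k-th summand, with the exceptional factor in position k, is a product of functions of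
    the single matrices.\<close>
  define h where "h k l X = (if l = k then ennreal (q X) else ennreal (opnorm X powr s))" for k l :: nat and X
  have [measurable]: "h k l \<in> borel_measurable borel" for k l unfolding h_def by measurable
  define D where "D = d powr (d * s)"
  have prod_h: "(\<Prod>l\<in>{1..?n}. h k l (A l))
      = ennreal (q (A k) * (\<Prod>l\<in>{1..?n} - {k}. opnorm (A l) powr s))" if "k \<in> {1..?n}" for k and A
  proof -
    have "(\<Prod>l\<in>{1..?n}. h k l (A l)) = h k k (A k) * (\<Prod>l\<in>{1..?n} - {k}. h k l (A l))"
      using that by (intro prod.remove) auto
    also have "(\<Prod>l\<in>{1..?n} - {k}. h k l (A l)) = (\<Prod>l\<in>{1..?n} - {k}. ennreal (opnorm (A l) powr s))"
      by (intro prod.cong) (auto simp: h_def)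
    also have "\<dots> = ennreal (\<Prod>l\<in>{1..?n} - {k}. opnorm (A l) powr s)"
      by (intro prod_ennreal) simp
    also have "h k k (A k) * \<dots> = ennreal (q (A k) * (\<Prod>l\<in>{1..?n} - {k}. opnorm (A l) powr s))"
      unfolding h_def by (simp add: ennreal_mult q0 prod_nonneg)
    finally show ?thesis .
  qed
  have "(\<Sum>k\<in>{1..?n}. \<integral>\<^sup>+A. (\<Prod>l\<in>{1..?n}. h k l (A l)) \<partial>P ?n)
      \<le> (\<Sum>k\<in>{1..?n}. ennreal (a * d powr (1 + r)) * norm_moment \<mu> s ^ (?n - 1))"
  proof (rule sum_mono)
    fix k assume k: "k \<in> {1..?n}"
    have "(\<integral>\<^sup>+A. (\<Prod>l\<in>{1..?n}. h k l (A l)) \<partial>P ?n) = (\<Prod>l\<in>{1..?n}. \<integral>\<^sup>+X. h k l X \<partial>\<mu>)"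
      by (rule product_nn_integral_prod) auto
    also have "\<dots> = (\<integral>\<^sup>+X. h k k X \<partial>\<mu>) * (\<Prod>l\<in>{1..?n} - {k}. \<integral>\<^sup>+X. h k l X \<partial>\<mu>)"
      using k by (intro prod.remove) auto
    also have "(\<Prod>l\<in>{1..?n} - {k}. \<integral>\<^sup>+X. h k l X \<partial>\<mu>) = (\<Prod>l\<in>{1..?n} - {k}. norm_moment \<mu> s)"
      unfolding norm_moment_def by (intro prod.cong refl) (auto simp: h_def)
    also have "\<dots> = norm_moment \<mu> s ^ (?n - 1)" using k by simp
    also have "(\<integral>\<^sup>+X. h k k X \<partial>\<mu>) \<le> ennreal (a * d powr (1 + r))"
      using int_q unfolding h_def by simp
    finally show "(\<integral>\<^sup>+A. (\<Prod>l\<in>{1..?n}. h k l (A l)) \<partial>P ?n)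
        \<le> ennreal (a * d powr (1 + r)) * norm_moment \<mu> s ^ (?n - 1)"
      by (simp add: mult_right_mono)
  qed
  also have "\<dots> = ennreal d * (ennreal (a * d powr (1 + r)) * norm_moment \<mu> s ^ (?n - 1))"
    unfolding d_def by (simp add: ennreal_of_nat_eq_real_of_nat)
  finally have sum_int: "(\<Sum>k\<in>{1..?n}. \<integral>\<^sup>+A. (\<Prod>l\<in>{1..?n}. h k l (A l)) \<partial>P ?n)
      \<le> ennreal d * (ennreal (a * d powr (1 + r)) * norm_moment \<mu> s ^ (?n - 1))" .
  have "moment ?n \<le> (\<integral>\<^sup>+A. ennreal D * (\<Sum>k\<in>{1..?n}. \<Prod>l\<in>{1..?n}. h k l (A l)) \<partial>P ?n)"
    unfolding moment_eq
  proof (rule nn_integral_mono)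
    fix A :: "nat \<Rightarrow> real^'n^'n"
    have "opnorm (mat_prod ?n A) powr s \<le> D * (\<Sum>k\<in>{1..?n}. (q (A k) powr (1 / s)) powr s *
        (\<Prod>l\<in>{1..?n} - {k}. opnorm (A l) powr s))"
      unfolding D_def d_def by (rule opnorm_mat_prod_powr_le[OF unit expand entry s_pos])
    also have "\<dots> = D * (\<Sum>k\<in>{1..?n}. q (A k) * (\<Prod>l\<in>{1..?n} - {k}. opnorm (A l) powr s))"
      using s_pos by (simp add: powr_powr q0)
    finally have "ennreal (opnorm (mat_prod ?n A) powr s)
        \<le> ennreal (D * (\<Sum>k\<in>{1..?n}. q (A k) * (\<Prod>l\<in>{1..?n} - {k}. opnorm (A l) powr s)))"
      by (rule ennreal_leI)
    also have "\<dots> = ennreal D * ennreal (\<Sum>k\<in>{1..?n}. q (A k) * (\<Prod>l\<in>{1..?n} - {k}. opnorm (A l) powr s))"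
      unfolding D_def by (intro ennreal_mult sum_nonneg mult_nonneg_nonneg q0 prod_nonneg) auto
    also have "ennreal (\<Sum>k\<in>{1..?n}. q (A k) * (\<Prod>l\<in>{1..?n} - {k}. opnorm (A l) powr s))
        = (\<Sum>k\<in>{1..?n}. ennreal (q (A k) * (\<Prod>l\<in>{1..?n} - {k}. opnorm (A l) powr s)))"
      by (intro sum_ennreal[symmetric] mult_nonneg_nonneg q0 prod_nonneg) auto
    also have "\<dots> = (\<Sum>k\<in>{1..?n}. \<Prod>l\<in>{1..?n}. h k l (A l))"
      by (intro sum.cong refl prod_h[symmetric])
    finally show "ennreal (opnorm (mat_prod ?n A) powr s)
        \<le> ennreal D * (\<Sum>k\<in>{1..?n}. \<Prod>l\<in>{1..?n}. h k l (A l))" .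
  qed
  also have "\<dots> = ennreal D * (\<integral>\<^sup>+A. (\<Sum>k\<in>{1..?n}. \<Prod>l\<in>{1..?n}. h k l (A l)) \<partial>P ?n)"
    by (rule nn_integral_cmult) measurable
  also have "(\<integral>\<^sup>+A. (\<Sum>k\<in>{1..?n}. \<Prod>l\<in>{1..?n}. h k l (A l)) \<partial>P ?n)
      = (\<Sum>k\<in>{1..?n}. \<integral>\<^sup>+A. (\<Prod>l\<in>{1..?n}. h k l (A l)) \<partial>P ?n)"
    by (rule nn_integral_sum) measurable
  also have "ennreal D * (\<Sum>k\<in>{1..?n}. \<integral>\<^sup>+A. (\<Prod>l\<in>{1..?n}. h k l (A l)) \<partial>P ?n)
      \<le> ennreal D * (ennreal d * (ennreal (a * d powr (1 + r)) * norm_moment \<mu> s ^ (?n - 1)))"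
    by (rule mult_left_mono[OF sum_int]) simp
  also have "\<dots> = ennreal (D * (d * (a * d powr (1 + r)))) * norm_moment \<mu> s ^ (?n - 1)"
    using a0 d1 unfolding D_def by (simp add: ennreal_mult mult.assoc)
  also have "D * (d * (a * d powr (1 + r))) = K_const d s * a"
  proof -
    have "max (d powr (1 - s)) 1 = d powr (max (1 - s) 0)"
    proof (cases "s \<le> 1")
      case True
      then have "1 \<le> d powr (1 - s)" using d1 by (intro ge_one_powr_ge_zero) auto
      then show ?thesis using True by simp
    next
      case False
      then have "d powr (1 - s) \<le> d powr 0" using d1 by (intro powr_mono) auto
      then show ?thesis using False d1 by simp
    qed
    then have "K_const d s = d powr (2 + (d + 1) * s + max (1 - s) 0)"
      unfolding K_const_def by (simp add: powr_add)
    also have "2 + (d + 1) * s + max (1 - s) 0 = d * s + (1 + (1 + r))"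
      unfolding r_def by (auto simp: max_def algebra_simps)
    also have "d powr (d * s + (1 + (1 + r))) = D * (d * d powr (1 + r))"
      using d1 unfolding D_def by (simp add: powr_add power2_eq_square)
    finally show ?thesis by simp
  qed
  finally show ?thesis unfolding d_def .
qed

lemma moment_dim_le_pressure:
  "moment CARD('n) \<le> ennreal (K_const (real CARD('n)) s) * eexp (norm_pressure \<mu> s)
    * norm_moment \<mu> s ^ (CARD('n) - 1)"
proof -
  define K where "K = K_const (real CARD('n)) s"
  define e where "e = enn2real (eexp (norm_pressure \<mu> s))"
  define M where "M = enn2real (norm_moment \<mu> s) ^ (CARD('n) - 1)"
  define x where "x = enn2real (moment CARD('n))"
  have K0: "K \<ge> 0" unfolding K_def K_const_def by simp
  have e: "eexp (norm_pressure \<mu> s) = ennreal e" and e0: "e \<ge> 0"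
    unfolding e_def using eexp_pressure_less_top by simp_all
  have M: "norm_moment \<mu> s ^ (CARD('n) - 1) = ennreal M" and M0: "M \<ge> 0"
    unfolding M_def using moment_finite by (simp_all add: ennreal_power[symmetric])
  have x: "moment CARD('n) = ennreal x" unfolding x_def using moment_less_top by simp
  have le: "x \<le> K * (e + t) * M" if t: "t > 0" for t
  proof -
    have "eexp (norm_pressure \<mu> s) < ennreal (e + t)"
      unfolding e using t e0 by (simp add: ennreal_less_iff)
    from moment_dim_le[OF this] have "ennreal x \<le> ennreal (K * (e + t) * M)"
      unfolding x M K_def[symmetric] using K0 e0 t M0 by (simp add: ennreal_mult del: ennreal_plus)
    then show ?thesis using K0 e0 t M0 by (subst (asm) ennreal_le_iff) auto
  qed
  have "((\<lambda>t. K * (e + t) * M) \<longlongrightarrow> K * (e + 0) * M) (at_right 0)"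
    by (intro tendsto_intros)
  moreover have "eventually (\<lambda>t. x \<le> K * (e + t) * M) (at_right 0)"
    using le by (auto simp: eventually_at_right[of 0 1] intro!: exI[of _ 1])
  ultimately have "x \<le> K * (e + 0) * M"
    by (rule tendsto_lowerbound) simp
  then show ?thesis
    unfolding x M e K_def[symmetric] using K0 e0 M0 by (simp add: ennreal_mult[symmetric] ennreal_leI)
qed

end

theorem theorem1p2:
  fixes \<mu> :: "(real^'n^'n) measure" and s :: real
  assumes "sets \<mu> = sets borel"
    and "s > 0"
    and "norm_moment \<mu> s < \<infinity>"
  shows "norm_moment (mat_conv \<mu> CARD('n)) s
    \<le> ennreal (K_const (real CARD('n)) s) * eexp (norm_pressure \<mu> s)
        * norm_moment \<mu> s ^ (CARD('n) - 1)"
proof -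
  let ?\<nu> = "nonzero_part \<mu>"
  have moment: "norm_moment ?\<nu> s = norm_moment \<mu> s"
    by (rule norm_moment_nonzero_part[OF assms(1,2)])
  have conv: "norm_moment (mat_conv ?\<nu> n) s = norm_moment (mat_conv \<mu> n) s" for n
    by (rule norm_moment_mat_conv_nonzero_part[OF assms(1,3,2)])
  have pressure: "norm_pressure ?\<nu> s = norm_pressure \<mu> s"
    unfolding norm_pressure_def conv ..
  interpret \<nu>: matrix_measure ?\<nu> s
  proof (intro matrix_measure.intro matrix_measure_axioms.intro)
    show "sigma_finite_measure ?\<nu>" by (rule sigma_finite_nonzero_part[OF assms(1,3)])
  qed (use assms moment in simp_all)
  show ?thesis using \<nu>.moment_dim_le_pressure unfolding moment conv pressure .
qed

end
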